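(* Let $\Omega_D\subset\mathbb{R}^{m+1}_*$ be a bounded axially symmetric domain, let $I\in\mathbb{S}$, and let $f\in C^1(\overline{\Omega_I})$ be $\mathcal{C}l_m$-valued. Then, for $\boldsymbol q\in\Omega_D$, $$\Pi_{\Omega_I}f(\boldsymbol q)=-\frac{1}{\pi}\int_{\Omega_I}(\boldsymbol x-\boldsymbol q)^{-*2}f(\boldsymbol x)\,dV_I(\boldsymbol x).$$
   Context: $\mathcal{C}l_m$ is the real Clifford algebra generated by $\boldsymbol e_1,\dots,\boldsymbol e_m$ with $\boldsymbol e_i\boldsymbol e_j+\boldsymbol e_j\boldsymbol e_i=-2\delta_{ij}$; $\overline{\cdot}$ denotes Clifford conjugation ($\overline{\boldsymbol e_A}=(-1)^{|A|(|A|+1)/2}\boldsymbol e_A$, extended linearly; it reverses products). $\mathbb{R}^{m+1}$ is identified with paravectors $\boldsymbol x=x_0+\underline{\boldsymbol x}$, $\underline{\boldsymbol x}=\sum_{j=1}^m x_j\boldsymbol e_j$, $\mathrm{Re}[\boldsymbol x]=x_0$, and $\mathbb{R}^{m+1}_*=\mathbb{R}^{m+1}\setminus\mathbb{R}$. $\mathbb{S}$ is the set of unit vectors $\underline{\boldsymbol x}$ with $|\underline{\boldsymbol x}|=1$ (so $I^2=-1$ for $I\in\mathbb S$), and $\mathbb{C}_I=\{u+Iv:u,v\in\mathbb R\}$. A domain $\Omega_D\subset\mathbb{R}^{m+1}_*$ is axially symmetric if $\Omega_D=\bigcup_{J\in\mathbb S}\{u+Jv: u+iv\in D\}$ for some open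 $D\subset\mathbb C$ invariant under complex conjugation; $\Omega_I:=\Omega_D\cap\mathbb C_I$ and $dV_I$ is two-dimensional Lebesgue measure on $\mathbb C_I$. The slice Cauchy kernel is $S^{-1}(\boldsymbol q,\boldsymbol x)=-(\boldsymbol q^2-2\mathrm{Re}[\boldsymbol x]\boldsymbol q+|\boldsymbol x|^2)^{-1}(\boldsymbol q-\overline{\boldsymbol x})$. Define $T_{\Omega_I}f(\boldsymbol q)=-\frac{1}{2\pi}\int_{\Omega_I}S^{-1}(\boldsymbol q,\boldsymbol x)f(\boldsymbol x)\,dV_I(\boldsymbol x)$, $\overline{G_{\boldsymbol q}}=\frac{\partial}{\partial q_0}-\frac{\underline{\boldsymbol q}}{|\underline{\boldsymbol q}|^2}\sum_{j=1}^m q_j\frac{\partial}{\partial q_j}$, and $\Pi_{\Omega_I}f(\boldsymbol q)=\overline{G_{\boldsymbol q}}\,T_{\Omega_I}f(\boldsymbol q)$. The kernel is $(\boldsymbol x-\boldsymbol q)^{-*2}:=(\boldsymbol q^2-2\mathrm{Re}[\boldsymbol x]\boldsymbol q+|\boldsymbol x|^2)^{-2}(\overline{\boldsymbol x}-\boldsymbol q)^{*2}$, where $(\overline{\boldsymbol x}-\boldsymbol q)^{*2}=\boldsymbol q^2-2\boldsymbol q\overline{\boldsymbol x}+\overline{\boldsymbol x}^2$ (slice $*$-square in the variable $\boldsymbol q$).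
   Formalization: The kernel is not Lebesgue integrable near the two points q_0 ± I|q_vec|, so the integral over Ω_I is taken as a Cauchy principal value: the limit as ε → 0+ of integrals over Ω_I with the closed ε-discs around these points removed. *)

theory Defs
  imports "HOL-Analysis.Analysis"
begin

text \<open>The generators e_1,...,e_m are indexed by a finite linearly ordered type 'n
  (so m = CARD('n)).  An element of Cl_m is its coefficient vector w.r.t. the basis
  e_A, A a subset of the generators (e_A = product of the e_a, a in A, in increasing order).\<close>

type_synonym 'n clif = "real ^ ('n set)"

text \<open>Sign in e_A e_B = sign A B e_(A symmetric-difference B), using e_i e_j + e_j e_i = -2 delta_ij.\<close>
definition cl_sign :: "'n::{finite,linorder} set \<Rightarrow> 'n set \<Rightarrow> real" where
  "cl_sign A B = (-1) ^ (card {(a, b). a \<in> A \<and> b \<in> B \<and> b < a} + card (A \<inter> B))"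

definition cl_mult :: "'n::{finite,linorder} clif \<Rightarrow> 'n clif \<Rightarrow> 'n clif" (infixl "\<odot>" 70) where
  "x \<odot> y = (\<chi> C. \<Sum>A\<in>UNIV. \<Sum>B\<in>UNIV.
      if (A - B) \<union> (B - A) = C then cl_sign A B * x $ A * y $ B else 0)"

definition cl_one :: "'n::finite clif" where
  "cl_one = (\<chi> A. if A = {} then 1 else 0)"

definition cl_scalar :: "real \<Rightarrow> 'n::finite clif" where
  "cl_scalar r = r *\<^sub>R cl_one"

definition cl_inv :: "'n::{finite,linorder} clif \<Rightarrow> 'n clif" where
  "cl_inv x = (THE y. x \<odot> y = cl_one \<and> y \<odot> x = cl_one)"

definition cl_conj :: "'n::finite clif \<Rightarrow> 'n clif" where
  "cl_conj x = (\<chi> A. (-1) ^ (card A * (card A + 1) div 2) * x $ A)"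

text \<open>A point of R^(m+1) is a pair (x_0, x_vec) with x_vec in R^m; it is identified with
  the paravector x_0 + sum_j x_j e_j in Cl_m.\<close>

definition para :: "real \<times> ((real, 'n::finite) vec) \<Rightarrow> 'n clif" where
  "para x = (\<chi> A. if A = {} then fst x
                  else if card A = 1 then snd x $ (THE j. A = {j}) else 0)"

definition unit_sph :: "((real, 'n::finite) vec) set" where
  "unit_sph = {J. norm J = 1}"

definition slice_pt :: "(real, 'n::finite) vec \<Rightarrow> real \<times> real \<Rightarrow> real \<times> ((real, 'n) vec)" where
  "slice_pt J p = (fst p, snd p *\<^sub>R J)"

definition axially_symmetric :: "(real \<times> ((real, 'n::finite) vec)) set \<Rightarrow> bool" where
  "axially_symmetric \<Omega> \<longleftrightarrow> (\<exists>D :: complex set. open D \<and> cnj ` D = D \<and>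
      \<Omega> = (\<Union>J\<in>unit_sph. {slice_pt J (Re z, Im z) | z. z \<in> D}))"

text \<open>Parameter domain of Omega_I = Omega_D intersected with C_I, via the isometry (u,v) |-> u + I v.
  Two-dimensional Lebesgue measure dV_I on C_I corresponds to Lebesgue measure on R^2.\<close>
definition slice_dom :: "(real \<times> ((real, 'n::finite) vec)) set \<Rightarrow> (real, 'n) vec \<Rightarrow> (real \<times> real) set" where
  "slice_dom \<Omega> I = {p. slice_pt I p \<in> \<Omega>}"

definition C1_closure :: "(real \<times> real) set \<Rightarrow> (real \<times> real \<Rightarrow> 'a::real_normed_vector) \<Rightarrow> bool" where
  "C1_closure U g \<longleftrightarrow> continuous_on (closure U) g \<and>
     (\<exists>gu gv. continuous_on (closure U) gu \<and> continuous_on (closure U) gv \<and>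
        (\<forall>p\<in>U. (g has_derivative (\<lambda>h. fst h *\<^sub>R gu p + snd h *\<^sub>R gv p)) (at p)))"

definition char_poly :: "real \<times> ((real, 'n) vec) \<Rightarrow> real \<times> ((real, 'n) vec) \<Rightarrow> 'n::{finite,linorder} clif" where
  "char_poly q x = para q \<odot> para q - (2 * fst x) *\<^sub>R para q + cl_scalar ((norm x)\<^sup>2)"

definition slice_cauchy :: "real \<times> ((real, 'n) vec) \<Rightarrow> real \<times> ((real, 'n) vec) \<Rightarrow> 'n::{finite,linorder} clif" where
  "slice_cauchy q x = - (cl_inv (char_poly q x) \<odot> (para q - cl_conj (para x)))"

definition kernel2 :: "real \<times> ((real, 'n) vec) \<Rightarrow> real \<times> ((real, 'n) vec) \<Rightarrow> 'n::{finite,linorder} clif" where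
  "kernel2 q x = (cl_inv (char_poly q x) \<odot> cl_inv (char_poly q x)) \<odot>
     (para q \<odot> para q - 2 *\<^sub>R (para q \<odot> cl_conj (para x))
        + cl_conj (para x) \<odot> cl_conj (para x))"

definition T_op :: "(real \<times> ((real, 'n) vec)) set \<Rightarrow> (real, 'n) vec \<Rightarrow>
    (real \<times> ((real, 'n) vec) \<Rightarrow> 'n::{finite,linorder} clif) \<Rightarrow> real \<times> ((real, 'n) vec) \<Rightarrow> 'n clif" where
  "T_op \<Omega> I f q = - (1 / (2 * pi)) *\<^sub>R
     integral (slice_dom \<Omega> I) (\<lambda>p. slice_cauchy q (slice_pt I p) \<odot> f (slice_pt I p))"

definition Gbar :: "(real \<times> ((real, 'n) vec) \<Rightarrow> 'n::{finite,linorder} clif) \<Rightarrow> real \<times> ((real, 'n) vec) \<Rightarrow> 'n clif" where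
  "Gbar h q =
     vector_derivative (\<lambda>t. h (q + (t, 0))) (at 0)
     - ((1 / (norm (snd q))\<^sup>2) *\<^sub>R para (0, snd q)) \<odot>
         (\<Sum>j\<in>UNIV. snd q $ j *\<^sub>R vector_derivative (\<lambda>t. h (q + (0, t *\<^sub>R axis j 1))) (at 0))"

definition Pi_op :: "(real \<times> ((real, 'n) vec)) set \<Rightarrow> (real, 'n) vec \<Rightarrow>
    (real \<times> ((real, 'n) vec) \<Rightarrow> 'n::{finite,linorder} clif) \<Rightarrow> real \<times> ((real, 'n) vec) \<Rightarrow> 'n clif" where
  "Pi_op \<Omega> I f q = Gbar (T_op \<Omega> I f) q"

text \<open>Principal-value truncation: Omega_I with the closed eps-discs (in C_I) around the two
  singular points q_0 +- I|q_vec| (= the sphere [q] intersected with C_I) removed.\<close>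
definition pv_dom :: "(real \<times> ((real, 'n::finite) vec)) set \<Rightarrow> (real, 'n) vec \<Rightarrow> real \<times> ((real, 'n) vec) \<Rightarrow> real \<Rightarrow> (real \<times> real) set" where
  "pv_dom \<Omega> I q \<epsilon> = {p \<in> slice_dom \<Omega> I.
      dist p (fst q, norm (snd q)) > \<epsilon> \<and> dist p (fst q, - norm (snd q)) > \<epsilon>}"

end

theory Submission
  imports Defs
begin

text \<open>Left multiplication by the slice \<open>C_I\<close> makes the Clifford algebra a complex vector space, and the
  representation formula splits both kernels into \<open>1 / (x - z)\<close> resp. \<open>1 / (x - z)\<^sup>2\<close> and the same with
  \<open>cnj z\<close>, multiplied from the left by coefficients that depend on the direction of \<open>q\<close> only and intertwine this
  direction with \<open>\<plusminus>I\<close>. So the theorem reduces to the planar fact that the holomorphic Wirtinger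
  derivative of the Cauchy transform is the principal value of the squared kernel. There the density
  is split as a radial bump times its value at the point plus a remainder vanishing there to first
  order: the bump contributes nothing by rotational symmetry, and the remainder turns the squared kernel into an
  integrable one.\<close>

section \<open>Weakly singular kernels in the plane\<close>

text \<open>Formal differentiation under the integral produces \<open>1 / (x - z)\<^sup>2\<close>,
  which is not integrable near \<open>z\<close> in the plane. So the kernel cannot be differentiated
  directly, and the right-hand side is a limit over domains with small discs removed. The density is
  known on one slice only, and its extension by zero may jump at the boundary. The planar argument
  therefore asks only for boundedness, compact support, measurability and differentiability at the
  single point in question; no Stokes formula is involved. The derivative of the Cauchy transform
  also contains a conjugate-linear term, a multiple of the value of the density. It is never
  evaluated: on a slice the operator \<open>Gbar\<close> acts as \<partial>_x - I \<partial>_y,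
  which annihilates that term and doubles the complex-linear one. This doubling turns the factor
  1/(2 pi) of \<open>T_op\<close> into 1/pi. All remainders are measured against |z - w| to the
  power -3/2. This majorant is locally integrable with an integral independent of the centre, it
  dominates 1/|z - w| on discs, and it controls a product of two such singularities at distance |d|
  with a loss of only |d| to the power -1/2.\<close>

lemma nn_integral_powr_interval_finite:
  fixes a R :: real
  assumes "a > -1" "R \<ge> 0"
  shows "(\<integral>\<^sup>+t. ennreal (indicator {-R..R} t * \<bar>t\<bar> powr a) \<partial>lborel) < \<infinity>"
proof -
  let ?k = "\<lambda>t::real. ennreal (indicator {0..R} t * t powr a)"
  have k: "(\<integral>\<^sup>+t. ?k t \<partial>lborel) < \<infinity>"
    using nn_integral_has_integral_lebesgue[OF _ has_integral_powr_from_0[OF assms]] by simp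
  have [measurable]: "?k \<in> borel_measurable borel" by measurable
  have k': "(\<integral>\<^sup>+t. ?k t \<partial>lborel) = (\<integral>\<^sup>+t. ?k (-t) \<partial>lborel)"
    using nn_integral_real_affine[of ?k "-1" 0] by simp
  have "(\<integral>\<^sup>+t. ennreal (indicator {-R..R} t * \<bar>t\<bar> powr a) \<partial>lborel) \<le> (\<integral>\<^sup>+t. ?k t + ?k (-t) \<partial>lborel)"
    by (intro nn_integral_mono) (auto simp: indicator_def)
  also have "\<dots> = (\<integral>\<^sup>+t. ?k t \<partial>lborel) + (\<integral>\<^sup>+t. ?k (-t) \<partial>lborel)"
    by (intro nn_integral_add) measurable
  also have "\<dots> < \<infinity>" using k k' by simp
  finally show ?thesis .
qed

lemma borel_measurable_indicator_cball_norm_powr [measurable]: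
  "(\<lambda>z::complex. indicator (cball w R) z * norm (z - w) powr a) \<in> borel_measurable borel"
proof -
  have [measurable]: "cball w R \<in> sets borel" by (intro borel_closed) simp
  show ?thesis by measurable
qed

text \<open>Since |z| is at least |Re z| and |Im z|, the power -3/2 of |z| is at most the product of
  the powers -3/4 of the coordinates, each integrable on bounded intervals. A product integral thus
  replaces polar coordinates. The exponent lies midway between -1, the order of the Cauchy kernel,
  and -2, where integrability in the plane fails.\<close>

lemma integrable_norm_powr_cball_0:
  "integrable lborel (\<lambda>z::complex. indicator (cball 0 R) z * norm z powr (-3/2))"
proof (rule integrableI_bounded)
  \<comment> \<open>\<open>0 powr a\<close> is 0, so without the value \<infinity> at
    \<open>t = 0\<close> the product bound would fail on the coordinate axes; a single point does
    not change the integral.\<close>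
  let ?k = "\<lambda>t::real. if t = 0 then \<infinity> else ennreal (indicator {-\<bar>R\<bar>..\<bar>R\<bar>} t * \<bar>t\<bar> powr (-3/4))"
  have [measurable]: "?k \<in> borel_measurable borel" by measurable
  have k: "(\<integral>\<^sup>+t. ?k t \<partial>lborel) < \<infinity>"
  proof -
    have "AE t in lborel. ?k t = ennreal (indicator {-\<bar>R\<bar>..\<bar>R\<bar>} t * \<bar>t\<bar> powr (-3/4))"
      using AE_lborel_singleton[of "0::real"] by eventually_elim auto
    then have "(\<integral>\<^sup>+t. ?k t \<partial>lborel) = (\<integral>\<^sup>+t. ennreal (indicator {-\<bar>R\<bar>..\<bar>R\<bar>} t * \<bar>t\<bar> powr (-3/4)) \<partial>lborel)"
      by (rule nn_integral_cong_AE)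
    then show ?thesis using nn_integral_powr_interval_finite[of "-3/4" "\<bar>R\<bar>"] by simp
  qed
  have bound: "ennreal (norm (indicator (cball 0 R) z * norm z powr (-3/2))) \<le> (\<Prod>b\<in>Basis. ?k (z \<bullet> b))"
    for z :: complex
  proof (cases "z \<in> cball 0 R \<and> Re z \<noteq> 0 \<and> Im z \<noteq> 0")
    case True
    then have z: "z \<in> cball 0 R" "Re z \<noteq> 0" "Im z \<noteq> 0" by auto
    then have R: "\<bar>Re z\<bar> \<le> \<bar>R\<bar>" "\<bar>Im z\<bar> \<le> \<bar>R\<bar>"
      using abs_Re_le_cmod[of z] abs_Im_le_cmod[of z] by auto
    have "norm z powr (-3/2) = norm z powr (-3/4) * norm z powr (-3/4)"
      by (simp flip: powr_add)
    also have "\<dots> \<le> \<bar>Re z\<bar> powr (-3/4) * \<bar>Im z\<bar> powr (-3/4)"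
      using z by (intro mult_mono powr_mono2') (auto simp: abs_Re_le_cmod abs_Im_le_cmod)
    finally show ?thesis
      using z R by (simp add: Basis_complex_def indicator_def abs_le_iff ennreal_mult[symmetric] ennreal_leI)
  next
    case False
    then consider "z \<notin> cball 0 R" | "z = 0" | "z \<in> cball 0 R" "Re z = 0" "Im z \<noteq> 0"
      | "z \<in> cball 0 R" "Re z \<noteq> 0" "Im z = 0" by (auto simp: complex_eq_iff)
    then show ?thesis
    proof cases
      case 3
      then have "\<bar>Im z\<bar> \<le> \<bar>R\<bar>" using abs_Im_le_cmod[of z] by auto
      with 3 show ?thesis
        by (auto simp: Basis_complex_def indicator_def abs_le_iff ennreal_mult_top ennreal_top_mult)
    next
      case 4
      then have "\<bar>Re z\<bar> \<le> \<bar>R\<bar>" using abs_Re_le_cmod[of z] by auto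
      with 4 show ?thesis
        by (auto simp: Basis_complex_def indicator_def abs_le_iff ennreal_mult_top ennreal_top_mult)
    qed auto
  qed
  have "(\<integral>\<^sup>+z. ennreal (norm (indicator (cball 0 R) z * norm z powr (-3/2))) \<partial>(lborel::complex measure))
      \<le> (\<integral>\<^sup>+z. (\<Prod>b\<in>Basis. ?k (z \<bullet> b)) \<partial>(lborel::complex measure))"
    by (intro nn_integral_mono bound)
  also have "\<dots> = (\<Prod>b\<in>(Basis::complex set). (\<integral>\<^sup>+t. ?k t \<partial>lborel))"
    by (rule nn_integral_lborel_prod) auto
  also have "\<dots> < \<infinity>" using k by (simp add: Basis_complex_def ennreal_mult_less_top)
  finally show "(\<integral>\<^sup>+z. ennreal (norm (indicator (cball 0 R) z * norm z powr (-3/2))) \<partial>(lborel::complex measure)) < \<infinity>" .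
qed (use borel_measurable_indicator_cball_norm_powr[of 0] in simp)

section \<open>Invariance of planar Lebesgue measure under quarter turns and translations\<close>

lemma lborel_distr_ii_mult: "distr lborel borel ((*) \<i>) = lborel"
proof (rule lborel_eqI[symmetric])
  fix l u :: complex assume le: "\<And>b. b \<in> Basis \<Longrightarrow> l \<bullet> b \<le> u \<bullet> b"
  have *: "Re l \<le> Re u" "Im l \<le> Im u" using le[of 1] le[of \<i>] by (auto simp: Basis_complex_def)
  have "(*) \<i> -` box l u = box (Complex (Im l) (- Re u)) (Complex (Im u) (- Re l))"
    by (auto simp: box_def Basis_complex_def)
  then show "emeasure (distr lborel borel ((*) \<i>)) (box l u) = (\<Prod>b\<in>Basis. (u - l) \<bullet> b)"
    using * by (simp add: emeasure_distr emeasure_lborel_box_eq Basis_complex_def mult.commute)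
qed simp

lemma integral_ii_mult:
  fixes f :: "complex \<Rightarrow> 'b::{banach, second_countable_topology}"
  assumes [measurable]: "f \<in> borel_measurable borel"
  shows "(\<integral>z. f (\<i> * z) \<partial>lborel) = (\<integral>z. f z \<partial>lborel)"
  by (subst (2) lborel_distr_ii_mult[symmetric], subst integral_distr) auto

lemma integrable_translation:
  fixes f :: "'a::euclidean_space \<Rightarrow> 'b::{banach, second_countable_topology}"
  assumes "integrable lborel f"
  shows "integrable lborel (\<lambda>z. f (c + z))"
  by (rule integrable_distr[where T="(+) c" and M'=lborel]) (use assms lborel_distr_plus[of c] in \<open>auto cong: distr_cong\<close>)

lemma integral_translation:
  fixes f :: "'a::euclidean_space \<Rightarrow> 'b::{banach, second_countable_topology}"
  assumes [measurable]: "f \<in> borel_measurable borel"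
  shows "(\<integral>z. f (c + z) \<partial>lborel) = (\<integral>z. f z \<partial>lborel)"
  by (subst (2) lborel_distr_plus[of c, symmetric], subst integral_distr) auto

definition disc_const :: "real \<Rightarrow> real"
  where "disc_const R = (\<integral>z. indicator (cball (0::complex) R) z * norm z powr (-3/2) \<partial>lborel)"

lemma
  fixes w :: complex
  shows integrable_norm_powr_cball:
      "integrable lborel (\<lambda>z. indicator (cball w R) z * norm (z - w) powr (-3/2))" (is ?A)
    and integral_norm_powr_cball:
      "(\<integral>z. indicator (cball w R) z * norm (z - w) powr (-3/2) \<partial>lborel) = disc_const R" (is ?B)
proof -
  have eq: "indicator (cball w R) z * norm (z - w) powr (-3/2)
      = indicator (cball 0 R) (-w + z) * norm (-w + z) powr (-3/2)" for z
    by (auto simp: indicator_def dist_norm norm_minus_commute)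
  show ?A unfolding eq
    by (rule integrable_translation[OF integrable_norm_powr_cball_0])
  show ?B unfolding eq disc_const_def
    by (rule integral_translation[where f="\<lambda>z. indicator (cball 0 R) z * norm z powr (-3/2)"])
      (use borel_measurable_indicator_cball_norm_powr[of 0] in simp)
qed

lemma inverse_norm_le_powr:
  assumes "norm z \<le> R" 
  shows "1 / norm z \<le> sqrt R * norm (z::complex) powr (-3/2)"
proof (cases "z = 0")
  case False
  have "1 / norm z = norm z powr (-1)"
    using False by (simp add: powr_minus_divide)
  also have "\<dots> = norm z powr (1/2 + -3/2)" by simp
  also have "\<dots> = norm z powr (1/2) * norm z powr (-3/2)"
    by (rule powr_add)
  also have "\<dots> \<le> sqrt R * norm z powr (-3/2)"
    using assms by (intro mult_right_mono) (auto simp: powr_half_sqrt)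
  finally show ?thesis .
qed auto

text \<open>The larger of the two norms is at least |d|/2. Half a power of it is bounded by
  \<open>sqrt (2 / norm d)\<close>, and its other half power is traded for the smaller norm, which
  leaves a single singularity of order 3/2. Adding both candidates avoids having to know which norm
  is smaller.\<close>

lemma inverse_norm_mult_le_powr:
  fixes a b :: complex
  assumes "a - b = d" "d \<noteq> 0"
  shows "1 / (norm a * norm b) \<le> sqrt (2 / norm d) * (norm a powr (-3/2) + norm b powr (-3/2))"
proof -
  have *: "1 / (norm a * norm b) \<le> sqrt (2 / norm d) * norm b powr (-3/2)"
    if "a - b = d \<or> b - a = d" "norm b \<le> norm a" "d \<noteq> 0" for a b :: complex
  proof (cases "b = 0")
    case False
    have "norm d \<le> norm a + norm b"
      using norm_triangle_ineq4[of a b] norm_triangle_ineq4[of b a] that by auto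
    then have d: "norm d / 2 \<le> norm a" "norm d > 0" using that by auto
    have "norm a powr (-1/2) \<le> (norm d / 2) powr (-1/2)"
      using d by (intro powr_mono2') auto
    also have "\<dots> = sqrt (2 / norm d)"
      using d by (simp add: powr_minus_divide powr_half_sqrt real_sqrt_divide)
    finally have 1: "norm a powr (-1/2) \<le> sqrt (2 / norm d)" .
    have 2: "norm a powr (-1/2) \<le> norm b powr (-1/2)"
      using that False by (intro powr_mono2') auto
    have "1 / (norm a * norm b) = norm a powr (-1/2) * (norm a powr (-1/2) * norm b powr (-1))"
      using d False by (simp add: powr_minus_divide flip: powr_add mult.assoc)
    also have "\<dots> \<le> sqrt (2 / norm d) * (norm b powr (-1/2) * norm b powr (-1))"
      using 1 2 by (intro mult_mono) auto
    also have "norm b powr (-1/2) * norm b powr (-1) = norm b powr (-1/2 + -1)"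
      by (rule powr_add[symmetric])
    also have "\<dots> = norm b powr (-3/2)" by simp
    finally show ?thesis .
  qed auto
  show ?thesis
  proof (cases "norm b \<le> norm a")
    case True
    have "1 / (norm a * norm b) \<le> sqrt (2 / norm d) * norm b powr (-3/2)"
      using * assms True by blast
    also have "\<dots> \<le> sqrt (2 / norm d) * (norm a powr (-3/2) + norm b powr (-3/2))"
      by (intro mult_left_mono) auto
    finally show ?thesis .
  next
    case False
    have "1 / (norm b * norm a) \<le> sqrt (2 / norm d) * norm a powr (-3/2)"
      using * assms False by (intro *) auto
    also have "\<dots> \<le> sqrt (2 / norm d) * (norm a powr (-3/2) + norm b powr (-3/2))"
      by (intro mult_left_mono) auto
    finally show ?thesis by (simp add: mult.commute)
  qed
qed

section \<open>A radial bump with Lipschitz gradient\<close>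

definition cutoff :: "real \<Rightarrow> complex \<Rightarrow> real"
  where "cutoff r z = (max 0 (1 - (norm z)\<^sup>2 / r\<^sup>2))\<^sup>2"

text \<open>The gradient of \<open>cutoff r\<close> at \<open>z\<close> is
  \<open>cutoff_slope r z *\<^sub>R z\<close>. Squaring the positive part is the cheapest way to get
  a compactly supported radial function with an explicit second-order Taylor bound, and no higher
  smoothness is used.\<close>

definition cutoff_slope :: "real \<Rightarrow> complex \<Rightarrow> real"
  where "cutoff_slope r z = - 4 / r\<^sup>2 * max 0 (1 - (norm z)\<^sup>2 / r\<^sup>2)"

lemma cutoff_measurable [measurable]: "cutoff r \<in> borel_measurable borel"
  and cutoff_slope_measurable [measurable]: "cutoff_slope r \<in> borel_measurable borel"
  unfolding cutoff_def cutoff_slope_def by measurable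

lemma cutoff_nonneg: "0 \<le> cutoff r z"
  and cutoff_le_1: "cutoff r z \<le> 1"
  by (auto simp: cutoff_def power_le_one_iff)

lemma cutoff_eq_0: "r > 0 \<Longrightarrow> r \<le> norm z \<Longrightarrow> cutoff r z = 0"
  and cutoff_slope_eq_0: "r > 0 \<Longrightarrow> r \<le> norm z \<Longrightarrow> cutoff_slope r z = 0"
  by (auto simp: cutoff_def cutoff_slope_def power_mono)

lemma abs_cutoff_slope_le: "r > 0 \<Longrightarrow> \<bar>cutoff_slope r z\<bar> \<le> 4 / r\<^sup>2"
  by (auto simp: cutoff_slope_def abs_mult divide_simps max_def)

lemma cutoff_ii_mult [simp]: "cutoff r (\<i> * z) = cutoff r z"
  and cutoff_slope_ii_mult [simp]: "cutoff_slope r (\<i> * z) = cutoff_slope r z"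
  by (auto simp: cutoff_def cutoff_slope_def norm_mult)

text \<open>The function \<open>(max 0 t)\<^sup>2\<close> has derivative \<open>2 * max 0 t\<close>,
  which is Lipschitz with constant 2; this is its first-order Taylor remainder.\<close>

lemma square_max_taylor:
  fixes s t :: real
  shows "\<bar>(max 0 t)\<^sup>2 - (max 0 s)\<^sup>2 - 2 * max 0 s * (t - s)\<bar> \<le> (t - s)\<^sup>2"
proof -
  consider "0 \<le> s" "0 \<le> t" | "0 \<le> s" "t \<le> 0" | "s \<le> 0" "0 \<le> t" | "s \<le> 0" "t \<le> 0" by linarith
  then show ?thesis
  proof cases
    case 1
    then have "(max 0 t)\<^sup>2 - (max 0 s)\<^sup>2 - 2 * max 0 s * (t - s) = (t - s)\<^sup>2"
      by (simp add: power2_eq_square algebra_simps)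
    then show ?thesis by simp
  next
    case 2
    then have "s * t \<le> 0" "0 \<le> s * s"
      using mult_nonneg_nonpos[of s t] by auto
    then have "2 * s * t \<le> s * s" by linarith
    with 2 show ?thesis by (simp add: max_def power2_eq_square algebra_simps)
  next
    case 3
    then have "t\<^sup>2 \<le> (t - s)\<^sup>2" by (intro power_mono) auto
    with 3 show ?thesis by (auto simp: max_def)
  next
    case 4 then show ?thesis by (auto simp: max_def)
  qed
qed

text \<open>Expanding |z + d|^2 leaves the quadratic term |d|^2 in the increment of 1 - |z|^2/r^2.
  The first summand of the bound is the Taylor remainder of the squared positive part, the second
  the contribution of that quadratic term to its linear part.\<close>

lemma cutoff_taylor:
  assumes "r > 0"
  shows "\<bar>cutoff r (z + d) - cutoff r z - cutoff_slope r z * (z \<bullet> d)\<bar>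
    \<le> ((2 * norm z * norm d + (norm d)\<^sup>2) / r\<^sup>2)\<^sup>2 + 2 * (norm d)\<^sup>2 / r\<^sup>2"
proof -
  let ?s = "1 - (norm z)\<^sup>2 / r\<^sup>2" and ?t = "1 - (norm (z + d))\<^sup>2 / r\<^sup>2"
  have n: "(norm (z + d))\<^sup>2 = (norm z)\<^sup>2 + 2 * (z \<bullet> d) + (norm d)\<^sup>2"
    by (simp add: power2_norm_eq_inner inner_add_left inner_add_right inner_commute)
  have ts: "?t - ?s = - (2 * (z \<bullet> d) + (norm d)\<^sup>2) / r\<^sup>2"
    unfolding n by (simp add: add_divide_distrib diff_divide_distrib)
  have "\<bar>?t - ?s\<bar> = \<bar>2 * (z \<bullet> d) + (norm d)\<^sup>2\<bar> / r\<^sup>2"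
    unfolding ts by (simp only: abs_divide abs_minus_cancel abs_power2)
  also have "\<dots> \<le> (2 * norm z * norm d + (norm d)\<^sup>2) / r\<^sup>2"
  proof (rule divide_right_mono)
    show "\<bar>2 * (z \<bullet> d) + (norm d)\<^sup>2\<bar> \<le> 2 * norm z * norm d + (norm d)\<^sup>2"
      using Cauchy_Schwarz_ineq2[of z d] zero_le_power2[of "norm d"] by (simp only: mult.assoc)
  qed simp
  finally have "(?t - ?s)\<^sup>2 \<le> ((2 * norm z * norm d + (norm d)\<^sup>2) / r\<^sup>2)\<^sup>2"
    by (rule power2_le_iff_abs_le[THEN iffD2, rotated]) simp
  then have 1: "\<bar>(max 0 ?t)\<^sup>2 - (max 0 ?s)\<^sup>2 - 2 * max 0 ?s * (?t - ?s)\<bar>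
      \<le> ((2 * norm z * norm d + (norm d)\<^sup>2) / r\<^sup>2)\<^sup>2"
    using square_max_taylor[of ?t ?s] by linarith
  have 2: "max 0 ?s * ((norm d)\<^sup>2 / r\<^sup>2) \<le> 1 * ((norm d)\<^sup>2 / r\<^sup>2)" "0 \<le> max 0 ?s * ((norm d)\<^sup>2 / r\<^sup>2)"
    by (intro mult_right_mono mult_nonneg_nonneg; simp)+
  have "cutoff_slope r z * (z \<bullet> d) - 2 * max 0 ?s * (?t - ?s) = 2 * (max 0 ?s * ((norm d)\<^sup>2 / r\<^sup>2))"
    unfolding ts cutoff_slope_def by (simp add: add_divide_distrib diff_divide_distrib algebra_simps)
  moreover have "\<bar>a - b - c\<bar> \<le> X + 2 * k / q"
    if "\<bar>a - b - m\<bar> \<le> X" "c - m = 2 * n" "n \<le> 1 * (k / q)" "0 \<le> n" for a b c m n k q X :: real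
    using that by linarith
  ultimately show ?thesis
    using 1 2 unfolding cutoff_def by blast
qed

text \<open>This makes \<open>g z - cutoff r (z - w0) *\<^sub>R g w0\<close> vanish to first order
  at \<open>w0\<close>. With s = (|z|/r)^2 \<le> |z|/r inside the disc, 1 - (1 - s)^2 \<le> 2 s
  gives the constant 2; outside, the left side is 1 and the right side at least 2.\<close>

lemma abs_cutoff_minus_1_le:
  assumes "r > 0"
  shows "\<bar>cutoff r z - 1\<bar> \<le> 2 / r * norm z"
proof (cases "norm z \<le> r")
  case True
  then have *: "norm z / r \<le> 1" "0 \<le> norm z / r" using assms by auto
  then have sq: "(norm z / r)\<^sup>2 \<le> norm z / r" "(norm z / r)\<^sup>2 \<le> 1"
    using mult_left_le[OF *] power_le_one[OF *(2,1), of 2] by (auto simp only: power2_eq_square)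
  have "cutoff r z = (1 - (norm z / r)\<^sup>2)\<^sup>2"
    using sq by (simp add: cutoff_def power_divide)
  also have "\<dots> - 1 = - 2 * (norm z / r)\<^sup>2 + ((norm z / r)\<^sup>2)\<^sup>2"
    by (simp add: power2_eq_square algebra_simps)
  finally have "cutoff r z - 1 \<ge> - 2 * (norm z / r)"
    using sq zero_le_power2[of "(norm z / r)\<^sup>2"] by linarith
  then show ?thesis using cutoff_le_1[of r z] by simp
next
  case False
  then have "1 \<le> norm z / r" using assms by simp
  then have "1 \<le> 2 / r * norm z" by simp
  then show ?thesis using cutoff_nonneg[of r z] cutoff_le_1[of r z] by linarith
qed

section \<open>Integrals dominated by the model singularity\<close>

lemma integrable_singular_bound:
  fixes F :: "complex \<Rightarrow> 'b::{banach, second_countable_topology}"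
  assumes "F \<in> borel_measurable borel"
    and "\<And>z. norm (F z) \<le> C * (indicator (cball w R) z * norm (z - w) powr (-3/2))"
  shows "integrable lborel F"
proof (rule Bochner_Integration.integrable_bound)
  show "integrable lborel (\<lambda>z. C * (indicator (cball w R) z * norm (z - w) powr (-3/2)))"
    by (intro integrable_mult_right integrable_norm_powr_cball)
qed (use assms in \<open>auto intro!: AE_I2 order_trans[OF assms(2)] \<close>)

lemma norm_integral_singular_bound:
  fixes F :: "complex \<Rightarrow> 'b::{banach, second_countable_topology}"
  assumes "F \<in> borel_measurable borel"
    and "\<And>z. norm (F z) \<le> C * (indicator (cball w R) z * norm (z - w) powr (-3/2))"
  shows "norm (\<integral>z. F z \<partial>lborel) \<le> C * disc_const R"
proof -
  have "norm (\<integral>z. F z \<partial>lborel) \<le> (\<integral>z. norm (F z) \<partial>lborel)"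
    by (rule integral_norm_bound)
  also have "\<dots> \<le> (\<integral>z. C * (indicator (cball w R) z * norm (z - w) powr (-3/2)) \<partial>lborel)"
    using integrable_norm_powr_cball
    by (intro integral_mono integrable_norm integrable_singular_bound[OF assms] integrable_mult_right assms(2))
  finally show ?thesis
    by (simp only: integral_mult_right_zero integral_norm_powr_cball)
qed

lemma inverse_norm_le_singular:
  assumes "norm x \<le> M / norm (z - w)" "z \<notin> cball w R \<Longrightarrow> x = 0" "0 \<le> M"
  shows "norm x \<le> M * sqrt R * (indicator (cball w R) z * norm (z - w :: complex) powr (-3/2))"
proof (cases "z \<in> cball w R")
  case True
  then have "M * (1 / norm (z - w)) \<le> M * (sqrt R * norm (z - w) powr (-3/2))"
    using assms by (intro mult_left_mono inverse_norm_le_powr) (auto simp: dist_norm norm_minus_commute)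
  then show ?thesis using assms True by (simp add: mult.assoc)
qed (use assms in auto)

text \<open>A quarter turn preserves the measure, so the integral equals its own negative. The
  condition holds for a radial function times \<open>cnj z / z\<close> and for a radial function
  times \<open>1 / z\<^sup>2\<close>, the two integrals that have to vanish.\<close>

lemma integral_odd_rotation:
  fixes f :: "complex \<Rightarrow> 'b::{banach, second_countable_topology}"
  assumes "f \<in> borel_measurable borel" "\<And>z. f (\<i> * z) = - f z"
  shows "(\<integral>z. f z \<partial>lborel) = 0"
proof -
  have "- (\<integral>z. f z \<partial>lborel) = (\<integral>z. f z \<partial>lborel)"
    using integral_ii_mult[OF assms(1)] by (simp add: assms(2))
  then have "2 *\<^sub>R (\<integral>z. f z \<partial>lborel) = 0"
    by (metis add.right_inverse scaleR_2)
  then show ?thesis by simp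
qed

lemma integrable_cutoff_transform:
  fixes w0 w :: complex
  assumes r: "r > 0"
  shows "integrable lborel (\<lambda>z. complex_of_real (cutoff r (z - w0)) / (z - w))"
proof (rule integrable_singular_bound)
  fix z :: complex
  have "norm (z - w) \<le> norm (z - w0) + norm (w - w0)"
    using norm_triangle_ineq4[of "z - w0" "w - w0"] by simp
  then show "norm (complex_of_real (cutoff r (z - w0)) / (z - w))
      \<le> 1 * sqrt (r + norm (w - w0)) * (indicator (cball w (r + norm (w - w0))) z * norm (z - w) powr (-3/2))"
    using cutoff_eq_0[OF r, of "z - w0"] cutoff_le_1[of r "z - w0"] cutoff_nonneg[of r "z - w0"]
    by (intro inverse_norm_le_singular)
       (auto simp: norm_divide dist_norm norm_minus_commute intro!: divide_right_mono)
qed measurable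

text \<open>Translating the variable moves the differentiation from the kernel to the smooth bump; the
  holomorphic part of the derivative then is the integral of a radial function times
  \<open>cnj z / z\<close>, which is odd under the rotation by a right angle.\<close>

lemma cutoff_transform_has_derivative:
  fixes w0 :: complex
  assumes r: "r > 0"
  shows "\<exists>A. ((\<lambda>w. \<integral>z. complex_of_real (cutoff r (z - w0)) / (z - w) \<partial>lborel) has_derivative (\<lambda>d. A * cnj d)) (at w0)"
proof -
  \<comment> \<open>After the substitution \<open>z \<mapsto> z + w0 + d\<close> the increment
    \<open>d\<close> sits in the bump only; \<open>A\<close> and \<open>B\<close> are the resulting
    candidates for the partial derivatives in the real and imaginary directions.\<close>
  define A where "A = (\<integral>z. complex_of_real (cutoff_slope r z * Re z) / z \<partial>lborel)"
  define B where "B = (\<integral>z. complex_of_real (cutoff_slope r z * Im z) / z \<partial>lborel)"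
  have int: "integrable lborel (\<lambda>z. complex_of_real (cutoff_slope r z * u z) / z)"
    if [measurable]: "u \<in> borel_measurable borel" and u: "\<And>z. \<bar>u z\<bar> \<le> norm z" for u
  proof (rule integrable_singular_bound)
    fix z :: complex
    have "\<bar>cutoff_slope r z * u z\<bar> \<le> 4 / r\<^sup>2 * r"
    proof (cases "norm z \<le> r")
      case True
      then show ?thesis unfolding abs_mult using abs_cutoff_slope_le[OF r, of z] u[of z] r
        by (intro mult_mono) auto
    qed (use cutoff_slope_eq_0[OF r, of z] r in auto)
    then have "norm (complex_of_real (cutoff_slope r z * u z) / z) \<le> 4 / r\<^sup>2 * r / norm (z - 0)"
      unfolding norm_divide norm_of_real diff_0_right by (intro divide_right_mono) auto
    then show "norm (complex_of_real (cutoff_slope r z * u z) / z)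
        \<le> 4 / r\<^sup>2 * r * sqrt r * (indicator (cball 0 r) z * norm (z - 0) powr (-3/2))"
      using cutoff_slope_eq_0[OF r, of z] r
      by (intro inverse_norm_le_singular) auto
  qed measurable
  have intA: "integrable lborel (\<lambda>z. complex_of_real (cutoff_slope r z * Re z) / z)"
    and intB: "integrable lborel (\<lambda>z. complex_of_real (cutoff_slope r z * Im z) / z)"
    by (intro int; simp add: abs_Re_le_cmod abs_Im_le_cmod)+
  \<comment> \<open>\<open>A - \<i> * B\<close> is twice the holomorphic Wirtinger derivative. Once
    it vanishes, \<open>B = - \<i> * A\<close>, and the real-linear map given by \<open>A\<close>
    and \<open>B\<close> collapses to \<open>A * cnj d\<close>.\<close>
  have "A - \<i> * B = (\<integral>z. complex_of_real (cutoff_slope r z * Re z) / z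
      - \<i> * (complex_of_real (cutoff_slope r z * Im z) / z) \<partial>lborel)"
    unfolding A_def B_def
    using intA integrable_mult_right[OF intB, of \<i>]
    by (simp only: Bochner_Integration.integral_diff integral_mult_right_zero)
  also have "\<dots> = (\<integral>z. complex_of_real (cutoff_slope r z) * cnj z / z \<partial>lborel)"
  proof (intro Bochner_Integration.integral_cong refl)
    fix z
    have "cnj z = complex_of_real (Re z) - \<i> * complex_of_real (Im z)"
      by (simp add: complex_eq_iff)
    then have "complex_of_real (cutoff_slope r z) * cnj z
        = complex_of_real (cutoff_slope r z * Re z) - \<i> * complex_of_real (cutoff_slope r z * Im z)"
      by (simp only: of_real_mult right_diff_distrib mult_ac)
    then show "complex_of_real (cutoff_slope r z * Re z) / z - \<i> * (complex_of_real (cutoff_slope r z * Im z) / z)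
        = complex_of_real (cutoff_slope r z) * cnj z / z"
      by (simp only: diff_divide_distrib times_divide_eq_right)
  qed
  also have "\<dots> = 0"
  proof (rule integral_odd_rotation)
    have [measurable]: "cnj \<in> borel_measurable borel"
      by (intro borel_measurable_continuous_onI continuous_intros)
    show "(\<lambda>z. complex_of_real (cutoff_slope r z) * cnj z / z) \<in> borel_measurable borel"
      by measurable
  qed (simp only: cutoff_slope_ii_mult, simp)
  finally have "A = \<i> * B" by simp
  then have AB: "B = - \<i> * A" by simp
  have Acnj: "A * cnj d = (\<integral>z. complex_of_real (cutoff_slope r z * (z \<bullet> d)) / z \<partial>lborel)" for d
  proof -
    have "A * cnj d = complex_of_real (Re d) * A + complex_of_real (Im d) * B"
      unfolding AB by (simp add: complex_eq_iff algebra_simps)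
    also have "\<dots> = (\<integral>z. complex_of_real (Re d) * (complex_of_real (cutoff_slope r z * Re z) / z)
        + complex_of_real (Im d) * (complex_of_real (cutoff_slope r z * Im z) / z) \<partial>lborel)"
      unfolding A_def B_def
      using integrable_mult_right[OF intA, of "complex_of_real (Re d)"]
        integrable_mult_right[OF intB, of "complex_of_real (Im d)"]
      by (simp only: Bochner_Integration.integral_add integral_mult_right_zero)
    also have "\<dots> = (\<integral>z. complex_of_real (cutoff_slope r z * (z \<bullet> d)) / z \<partial>lborel)"
      by (intro Bochner_Integration.integral_cong refl)
         (simp add: inner_complex_def add_divide_distrib algebra_simps)
    finally show ?thesis .
  qed
  \<comment> \<open>\<open>C\<close> is the bound of \<open>cutoff_taylor\<close> for |z| \<le> r +
    1 and |d| < 1, divided by |d|^2; the disc of radius r + 1 contains the support of the bump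
    shifted by any such \<open>d\<close>.\<close>
  define C where "C = ((2 * (r + 1) + 1) / r\<^sup>2)\<^sup>2 + 2 / r\<^sup>2"
  define D where "D = sqrt (r + 1) * disc_const (r + 1)"
  let ?G = "\<lambda>d z. complex_of_real (cutoff r (z + d) - cutoff r z - cutoff_slope r z * (z \<bullet> d)) / z"
  have G: "norm (?G d z) \<le> C * (norm d)\<^sup>2 * sqrt (r + 1) * (indicator (cball 0 (r + 1)) z * norm (z - 0) powr (-3/2))"
    if d: "norm d < 1" for d z
  proof (rule inverse_norm_le_singular)
    have 0: "cutoff r (z + d) - cutoff r z - cutoff_slope r z * (z \<bullet> d) = 0" if "z \<notin> cball 0 (r + 1)"
    proof -
      have "norm z > r + 1" using that by simp
      moreover have "norm z \<le> norm (z + d) + norm d"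
        using norm_triangle_ineq4[of "z + d" d] by simp
      ultimately show ?thesis
        using d cutoff_eq_0[OF r, of "z + d"] cutoff_eq_0[OF r, of z] cutoff_slope_eq_0[OF r, of z] by simp
    qed
    then show "z \<notin> cball 0 (r + 1) \<Longrightarrow> ?G d z = 0" by simp
    have "\<bar>cutoff r (z + d) - cutoff r z - cutoff_slope r z * (z \<bullet> d)\<bar> \<le> C * (norm d)\<^sup>2"
    proof (cases "z \<in> cball 0 (r + 1)")
      case True
      have "2 * norm z * norm d + (norm d)\<^sup>2 \<le> 2 * (r + 1) * norm d + 1 * norm d"
        unfolding power2_eq_square using True d r by (intro add_mono mult_mono) auto
      then have "(2 * norm z * norm d + (norm d)\<^sup>2) / r\<^sup>2 \<le> (2 * (r + 1) + 1) / r\<^sup>2 * norm d"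
        by (simp add: divide_right_mono algebra_simps flip: add_divide_distrib)
      then have "((2 * norm z * norm d + (norm d)\<^sup>2) / r\<^sup>2)\<^sup>2 \<le> ((2 * (r + 1) + 1) / r\<^sup>2 * norm d)\<^sup>2"
        by (intro power_mono) auto
      then show ?thesis
        using cutoff_taylor[OF r, of z d] unfolding C_def power_mult_distrib distrib_right by simp
    next
      case False
      then show ?thesis using 0 by (simp add: C_def)
    qed
    then show "norm (?G d z) \<le> C * (norm d)\<^sup>2 / norm (z - 0)"
      by (auto simp: norm_divide intro!: divide_right_mono simp flip: of_real_mult of_real_diff)
  qed (auto simp: C_def)
  have intc: "integrable lborel (\<lambda>z. complex_of_real (cutoff r (z + d)) / z)" for d
    using integrable_cutoff_transform[OF r, of "- d" 0] by simp
  have shift: "(\<integral>z. complex_of_real (cutoff r (z - w0)) / (z - (w0 + d)) \<partial>lborel) = (\<integral>z. complex_of_real (cutoff r (z + d)) / z \<partial>lborel)" for d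
    by (subst integral_translation[symmetric, where c="w0 + d"]) (auto simp: algebra_simps)
  have rem: "norm ((\<integral>z. complex_of_real (cutoff r (z - w0)) / (z - (w0 + d)) \<partial>lborel)
      - (\<integral>z. complex_of_real (cutoff r (z - w0)) / (z - w0) \<partial>lborel) - A * cnj d) \<le> C * D * (norm d)\<^sup>2"
    if d: "norm d < 1" for d
  proof -
    have "(\<integral>z. complex_of_real (cutoff r (z - w0)) / (z - (w0 + d)) \<partial>lborel)
      - (\<integral>z. complex_of_real (cutoff r (z - w0)) / (z - w0) \<partial>lborel) - A * cnj d = (\<integral>z. ?G d z \<partial>lborel)"
    proof -
      have "integrable lborel (\<lambda>z. complex_of_real (cutoff_slope r z * (z \<bullet> d)) / z)"
        using integrable_mult_right[OF intA, of "complex_of_real (Re d)"]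
          integrable_mult_right[OF intB, of "complex_of_real (Im d)"]
        by (rule Bochner_Integration.integrable_add[THEN Bochner_Integration.integrable_cong[THEN iffD1, OF refl, rotated]])
           (simp add: inner_complex_def add_divide_distrib algebra_simps)
      then show ?thesis
        using intc[of d] intc[of 0] shift[of d] shift[of 0]
        by (simp add: Acnj diff_divide_distrib)
    qed
    also have "norm \<dots> \<le> C * (norm d)\<^sup>2 * sqrt (r + 1) * disc_const (r + 1)"
      by (rule norm_integral_singular_bound[OF _ G[OF d]]) measurable
    finally show ?thesis by (simp add: D_def mult_ac)
  qed
  have "((\<lambda>w. \<integral>z. complex_of_real (cutoff r (z - w0)) / (z - w) \<partial>lborel) has_derivative (\<lambda>d. A * cnj d)) (at w0)"
  proof (rule has_derivativeI_sandwich[where e=1 and H="\<lambda>y. C * D * norm (y - w0)"])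
    show "bounded_linear (\<lambda>d. A * cnj d)"
      by (intro bounded_linear_compose[OF bounded_linear_mult_right bounded_linear_cnj])
    show "((\<lambda>y. C * D * norm (y - w0)) \<longlongrightarrow> 0) (at w0)"
      by (auto intro!: tendsto_eq_intros)
    show "norm ((\<integral>z. complex_of_real (cutoff r (z - w0)) / (z - y) \<partial>lborel) - (\<integral>z. complex_of_real (cutoff r (z - w0)) / (z - w0) \<partial>lborel) - A * cnj (y - w0))
        / norm (y - w0) \<le> C * D * norm (y - w0)" if "y \<noteq> w0" "dist y w0 < 1" for y
      using rem[of "y - w0"] that by (simp add: divide_le_eq dist_norm power2_eq_square mult_ac)
  qed simp
  then show ?thesis by blast
qed

section \<open>Derivative and principal value of the Cauchy transform\<close>

text \<open>Scalars act on the left of values in a real Euclidean space, so that the planar analysis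
  never mentions the Clifford product. The action is only required to be bounded, not
  norm-preserving, whence the constant \<open>K\<close> in the estimates.\<close>

locale complex_action = bounded_bilinear act
  for act :: "complex \<Rightarrow> 'e::euclidean_space \<Rightarrow> 'e" (infixr "\<cdot>" 75) +
  assumes act_one: "1 \<cdot> x = x"
    and act_mult: "(z * w) \<cdot> x = z \<cdot> w \<cdot> x"
begin

lemma act_measurable [measurable (raw)]:
  assumes "\<phi> \<in> borel_measurable M" "h \<in> borel_measurable M"
  shows "(\<lambda>x. \<phi> x \<cdot> h x) \<in> borel_measurable M"
  by (rule borel_measurable_continuous_Pair[OF assms])
     (intro continuous_on continuous_on_fst continuous_on_snd continuous_on_id)

lemma act_integral_left:
  assumes "integrable M \<phi>"
  shows "integrable M (\<lambda>x. \<phi> x \<cdot> y)" and "(\<integral>x. \<phi> x \<cdot> y \<partial>M) = (\<integral>x. \<phi> x \<partial>M) \<cdot> y"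
  using integrable_bounded_linear[OF bounded_linear_left assms]
    integral_bounded_linear[OF bounded_linear_left assms] by auto

lemma act_integral_right:
  assumes "integrable M h"
  shows "integrable M (\<lambda>x. c \<cdot> h x)" and "(\<integral>x. c \<cdot> h x \<partial>M) = c \<cdot> (\<integral>x. h x \<partial>M)"
  using integrable_bounded_linear[OF bounded_linear_right assms]
    integral_bounded_linear[OF bounded_linear_right assms] by auto

lemma integrable_cauchy:
  assumes [measurable]: "h \<in> borel_measurable borel"
    and "\<And>z. norm (h z) \<le> M" "\<And>z. z \<notin> cball w R \<Longrightarrow> h z = 0"
  shows "integrable lborel (\<lambda>z. (1 / (z - w)) \<cdot> h z)"
proof -
  obtain K where K: "\<And>z x. norm (z \<cdot> x) \<le> norm z * norm x * K" "K > 0"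
    using pos_bounded by blast
  have M: "0 \<le> M" using assms(2)[of 0] norm_ge_zero order_trans by blast
  show ?thesis
  proof (rule integrable_singular_bound)
    show "norm ((1 / (z - w)) \<cdot> h z) \<le> M * K * sqrt R * (indicator (cball w R) z * norm (z - w) powr (-3/2))" for z
    proof (rule inverse_norm_le_singular)
      have "norm ((1 / (z - w)) \<cdot> h z) \<le> 1 / norm (z - w) * norm (h z) * K"
        using K(1)[of "1 / (z - w)" "h z"] by (simp add: norm_divide)
      also have "\<dots> \<le> 1 / norm (z - w) * M * K"
        using assms(2) K(2) by (intro mult_right_mono mult_left_mono) auto
      finally show "norm ((1 / (z - w)) \<cdot> h z) \<le> M * K / norm (z - w)" by simp
    qed (use assms(3) M K in \<open>auto simp: zero_right\<close>)
  qed measurable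
qed

text \<open>A first-order zero of the density at the singular point lowers the kernel from order 2
  to order 1, which is integrable in the plane.\<close>

lemma integrable_cauchy_square:
  assumes [measurable]: "h \<in> borel_measurable borel"
    and "\<And>z. norm (h z) \<le> L * norm (z - w)" "\<And>z. z \<notin> cball w R \<Longrightarrow> h z = 0" "0 \<le> L"
  shows "integrable lborel (\<lambda>z. (1 / (z - w)\<^sup>2) \<cdot> h z)"
proof -
  obtain K where K: "\<And>z x. norm (z \<cdot> x) \<le> norm z * norm x * K" "K > 0"
    using pos_bounded by blast
  show ?thesis
  proof (rule integrable_singular_bound)
    show "norm ((1 / (z - w)\<^sup>2) \<cdot> h z) \<le> L * K * sqrt R * (indicator (cball w R) z * norm (z - w) powr (-3/2))" for z
    proof (rule inverse_norm_le_singular)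
      have "norm ((1 / (z - w)\<^sup>2) \<cdot> h z) \<le> 1 / (norm (z - w))\<^sup>2 * norm (h z) * K"
        using K(1)[of "1 / (z - w)\<^sup>2" "h z"] by (simp add: norm_divide norm_power)
      also have "\<dots> \<le> 1 / (norm (z - w))\<^sup>2 * (L * norm (z - w)) * K"
        using assms(2) K(2) by (intro mult_right_mono mult_left_mono) auto
      finally show "norm ((1 / (z - w)\<^sup>2) \<cdot> h z) \<le> L * K / norm (z - w)"
        by (simp add: power2_eq_square split: if_splits)
    qed (use assms(3,4) K in \<open>auto simp: zero_right\<close>)
  qed measurable
qed

text \<open>Outside the disc around \<open>w0\<close> the kernel is at most
  \<open>1 / \<epsilon>\<^sup>2\<close>. The second excluded disc matches \<open>pv_dom\<close>,
  which cuts around both points where the sphere of \<open>q\<close> meets the slice.\<close>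

lemma integrable_cauchy_square_truncated:
  fixes w0 w1 :: complex
  assumes [measurable]: "g \<in> borel_measurable borel"
    and bnd: "\<And>z. norm (g z) \<le> M" and supp: "\<And>z. z \<notin> cball 0 R \<Longrightarrow> g z = 0"
    and \<epsilon>: "0 < \<epsilon>"
  shows "integrable lborel (\<lambda>z. indicator {z. dist z w0 > \<epsilon> \<and> dist z w1 > \<epsilon>} z *\<^sub>R (1 / (z - w0)\<^sup>2) \<cdot> g z)"
proof -
  obtain K where K: "\<And>z x. norm (z \<cdot> x) \<le> norm z * norm x * K" "K > 0"
    using pos_bounded by blast
  have M: "0 \<le> M" using bnd[of 0] norm_ge_zero order_trans by blast
  let ?V = "{z. dist z w0 > \<epsilon> \<and> dist z w1 > \<epsilon>}"
  have [measurable]: "?V \<in> sets borel"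
    by (intro borel_open open_Collect_conj open_Collect_less continuous_intros)
  show ?thesis
  proof (rule Bochner_Integration.integrable_bound[where f="\<lambda>z. 1 / \<epsilon>\<^sup>2 * M * K * indicator (cball 0 R) z"])
    show "integrable lborel (\<lambda>z::complex. 1 / \<epsilon>\<^sup>2 * M * K * indicator (cball 0 R) z :: real)"
      by (intro integrable_mult_right integrable_real_indicator emeasure_bounded_finite) simp_all
    have "norm (indicator ?V z *\<^sub>R (1 / (z - w0)\<^sup>2) \<cdot> g z) \<le> 1 / \<epsilon>\<^sup>2 * M * K * indicator (cball 0 R) z" for z
    proof (cases "z \<in> ?V \<and> z \<in> cball 0 R")
      case True
      then have "\<epsilon>\<^sup>2 \<le> (norm (z - w0))\<^sup>2" using \<epsilon> by (intro power_mono) (auto simp: dist_norm)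
      then have "norm (1 / (z - w0)\<^sup>2) \<le> 1 / \<epsilon>\<^sup>2"
        using \<epsilon> by (auto simp: norm_divide norm_power intro!: frac_le)
      then have "norm ((1 / (z - w0)\<^sup>2) \<cdot> g z) \<le> 1 / \<epsilon>\<^sup>2 * M * K"
        using K(2) M bnd by (intro order_trans[OF K(1)] mult_mono) auto
      then show ?thesis using True by simp
    qed (use supp[of z] K(2) M in \<open>auto simp: zero_right\<close>)
    then show "AE z in lborel. norm (indicator ?V z *\<^sub>R (1 / (z - w0)\<^sup>2) \<cdot> g z)
        \<le> norm (1 / \<epsilon>\<^sup>2 * M * K * indicator (cball 0 R) z :: real)"
      unfolding real_norm_def by (intro AE_I2 order_trans[OF _ abs_ge_self])
  qed measurable
qed

text \<open>After subtracting the expected derivative the kernel becomes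
  \<open>(w - w0)\<^sup>2 / ((z - w) (z - w0)\<^sup>2)\<close>; the zero of \<open>h\<close> cancels one factor.\<close>

lemma cauchy_transform_has_derivative_vanishing:
  assumes [measurable]: "h \<in> borel_measurable borel"
    and h: "\<And>z. norm (h z) \<le> L * norm (z - w0)" "\<And>z. z \<notin> cball w0 R \<Longrightarrow> h z = 0"
    and "0 \<le> L" "0 \<le> R"
  shows "((\<lambda>w. \<integral>z. (1 / (z - w)) \<cdot> h z \<partial>lborel) has_derivative
    (\<lambda>d. d \<cdot> (\<integral>z. (1 / (z - w0)\<^sup>2) \<cdot> h z \<partial>lborel))) (at w0)"
proof -
  obtain K where K: "\<And>z x. norm (z \<cdot> x) \<le> norm z * norm x * K" "K > 0"
    using pos_bounded by blast
  let ?s = "\<lambda>w R z. indicator (cball w R) z * norm (z - w) powr (-3/2) :: real"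
  define C where "C = sqrt 2 * K * L * (disc_const (R + 1) + disc_const R)"
  have hM: "norm (h z) \<le> L * R" for z
    using h[of z] \<open>0 \<le> L\<close> \<open>0 \<le> R\<close>
    by (cases "z \<in> cball w0 R") (auto simp: dist_norm norm_minus_commute intro: order_trans[OF _ mult_left_mono])
  have int1: "integrable lborel (\<lambda>z. (1 / (z - w)) \<cdot> h z)" if "norm (w - w0) < 1" for w
  proof (rule integrable_cauchy[OF _ hM, where R="R + 1"])
    fix z assume "z \<notin> cball w (R + 1)"
    then have "R < norm (z - w0)"
      using that norm_triangle_ineq4[of "z - w0" "w - w0"] by (simp add: dist_norm norm_minus_commute)
    then show "h z = 0" using h(2) by (simp add: dist_norm norm_minus_commute)
  qed measurable
  have int2: "integrable lborel (\<lambda>z. (1 / (z - w0)\<^sup>2) \<cdot> h z)"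
    by (rule integrable_cauchy_square[OF _ h \<open>0 \<le> L\<close>]) measurable
  have rem: "norm ((\<integral>z. (1 / (z - w)) \<cdot> h z \<partial>lborel) - (\<integral>z. (1 / (z - w0)) \<cdot> h z \<partial>lborel)
      - (w - w0) \<cdot> (\<integral>z. (1 / (z - w0)\<^sup>2) \<cdot> h z \<partial>lborel)) / norm (w - w0) \<le> C * sqrt (norm (w - w0))"
    if w: "w \<noteq> w0" "norm (w - w0) < 1" for w
  proof -
    define d where "d = w - w0"
    have d: "d \<noteq> 0" "norm d < 1" using w by (auto simp: d_def)
    define Q where "Q = sqrt (2 / norm d) * ((norm d)\<^sup>2 * K * L)"
    let ?D = "\<lambda>z. (1 / (z - w)) \<cdot> h z - (1 / (z - w0)) \<cdot> h z - d \<cdot> (1 / (z - w0)\<^sup>2) \<cdot> h z"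
    have intD: "integrable lborel ?D"
      using int1[OF w(2)] int1[of w0] act_integral_right(1)[OF int2, of d] by auto
    have s: "integrable lborel (\<lambda>z. Q * (?s w (R + 1) z + ?s w0 R z))"
      by (intro integrable_mult_right Bochner_Integration.integrable_add integrable_norm_powr_cball)
    \<comment> \<open>At \<open>z = w\<close> division by zero yields 0 and the kernel identity
      breaks down; the point is a null set, so the bound is used almost everywhere.\<close>
    have bound: "norm (?D z) \<le> Q * (?s w (R + 1) z + ?s w0 R z)" if "z \<noteq> w" for z
    proof (cases "z \<in> cball w0 R \<and> z \<noteq> w0")
      case True
      then have z: "z \<noteq> w0" "z \<in> cball w0 R" by auto
      then have zw: "z \<in> cball w (R + 1)"
        using norm_triangle_ineq4[of "z - w0" "w - w0"] w by (simp add: dist_norm norm_minus_commute)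
      have "?D z = (1 / (z - w) - 1 / (z - w0) - d * (1 / (z - w0)\<^sup>2)) \<cdot> h z"
        by (simp only: diff_left act_mult)
      also have "1 / (z - w) - 1 / (z - w0) - d * (1 / (z - w0)\<^sup>2) = d\<^sup>2 / ((z - w) * (z - w0)\<^sup>2)"
        using that z unfolding d_def by (simp add: divide_simps) (simp add: power2_eq_square algebra_simps)
      finally have "norm (?D z) \<le> norm (d\<^sup>2 / ((z - w) * (z - w0)\<^sup>2)) * norm (h z) * K"
        using K(1) by simp
      also have "\<dots> \<le> norm (d\<^sup>2 / ((z - w) * (z - w0)\<^sup>2)) * (L * norm (z - w0)) * K"
        using h(1) K(2) by (intro mult_right_mono mult_left_mono) auto
      also have "\<dots> = ((norm d)\<^sup>2 * K * L) * (1 / (norm (z - w) * norm (z - w0)))"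
        using z by (simp add: norm_divide norm_mult norm_power power2_eq_square)
      also have "\<dots> \<le> ((norm d)\<^sup>2 * K * L) *
          (sqrt (2 / norm (- d)) * (norm (z - w) powr (-3/2) + norm (z - w0) powr (-3/2)))"
        using d K(2) \<open>0 \<le> L\<close>
        by (intro mult_left_mono inverse_norm_mult_le_powr mult_nonneg_nonneg) (auto simp: d_def)
      finally show ?thesis
        using z zw by (simp add: Q_def mult_ac)
    next
      case False
      then have "h z = 0" using h(1)[of w0] h(2) by auto
      then show ?thesis using d K(2) \<open>0 \<le> L\<close> by (simp add: zero_right Q_def)
    qed
    have "norm ((\<integral>z. (1 / (z - w)) \<cdot> h z \<partial>lborel) - (\<integral>z. (1 / (z - w0)) \<cdot> h z \<partial>lborel)
      - d \<cdot> (\<integral>z. (1 / (z - w0)\<^sup>2) \<cdot> h z \<partial>lborel)) = norm (\<integral>z. ?D z \<partial>lborel)"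
      using int1[OF w(2)] int1[of w0] act_integral_right[OF int2, of d] by simp
    also have "\<dots> \<le> (\<integral>z. norm (?D z) \<partial>lborel)"
      by (rule integral_norm_bound)
    also have "\<dots> \<le> (\<integral>z. Q * (?s w (R + 1) z + ?s w0 R z) \<partial>lborel)"
      using AE_lborel_singleton[of w] bound
      by (intro integral_mono_AE integrable_norm intD s) (auto elim: eventually_mono)
    also have "\<dots> = Q * (disc_const (R + 1) + disc_const R)"
      by (simp only: integral_mult_right_zero integral_norm_powr_cball
          Bochner_Integration.integral_add[OF integrable_norm_powr_cball integrable_norm_powr_cball])
    \<comment> \<open>The total power of |d| is 2 - 1/2 = 3/2. Division by |d| in the difference
      quotient leaves \<open>sqrt (norm d)\<close>, which tends to 0.\<close>
    also have "Q = sqrt 2 * K * L * sqrt (norm d) * norm d"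
    proof -
      have "(norm d)\<^sup>2 = sqrt (norm d) * sqrt (norm d) * norm d"
        by (simp add: power2_eq_square)
      then show ?thesis
        using d by (simp add: Q_def real_sqrt_divide del: real_sqrt_mult_self)
    qed
    finally show ?thesis
      using d unfolding d_def C_def by (simp add: divide_le_eq mult_ac)
  qed
  show ?thesis
  proof (rule has_derivativeI_sandwich[where e=1 and H="\<lambda>w. C * sqrt (norm (w - w0))"])
    show "((\<lambda>w. C * sqrt (norm (w - w0))) \<longlongrightarrow> 0) (at w0)"
      by (auto intro!: tendsto_eq_intros)
  qed (use rem in \<open>auto simp: dist_norm bounded_linear_left\<close>)
qed

text \<open>Derivative and principal value share the same \<open>H\<close> because both reduce to
  the absolutely convergent integral of the squared kernel against the remainder \<open>h\<close>:
  the bump contributes only a conjugate-linear term to the derivative and nothing to the truncated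
  integrals. \<open>A\<close> stays unspecified, since conjugate-linear terms disappear in the final
  operator.\<close>

lemma cauchy_transform_has_derivative_pv:
  assumes [measurable]: "g \<in> borel_measurable borel"
    and bnd: "\<And>z. norm (g z) \<le> M" and supp: "\<And>z. z \<notin> cball 0 R \<Longrightarrow> g z = 0"
    and diff: "(g has_derivative g') (at w0)" and "w1 \<noteq> w0"
  obtains A H where
    "((\<lambda>w. \<integral>z. (1 / (z - w)) \<cdot> g z \<partial>lborel) has_derivative (\<lambda>d. (A * cnj d) \<cdot> g w0 + d \<cdot> H)) (at w0)"
    "((\<lambda>\<epsilon>. \<integral>z. indicator {z. dist z w0 > \<epsilon> \<and> dist z w1 > \<epsilon>} z *\<^sub>R (1 / (z - w0)\<^sup>2) \<cdot> g z \<partial>lborel)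
      \<longlongrightarrow> H) (at_right 0)"
proof -
  \<comment> \<open>With half the distance as radius, the disc removed around \<open>w1\<close>
    misses the support of the bump as soon as \<open>\<epsilon> < r\<close>, so the truncated bump
    stays rotationally symmetric about \<open>w0\<close>.\<close>
  define r where "r = dist w0 w1 / 2"
  have r: "r > 0" using assms by (simp add: r_def)
  define h where "h z = g z - cutoff r (z - w0) *\<^sub>R g w0" for z
  have hm [measurable]: "h \<in> borel_measurable borel" unfolding h_def[abs_def] by measurable
  have M: "0 \<le> M" using bnd[of 0] norm_ge_zero order_trans by blast
  have gw0: "norm (g w0) \<le> M" using bnd .
  have cut_le: "norm (cutoff r (z - w0) *\<^sub>R g w0) \<le> M" for z
    using mult_mono[OF cutoff_le_1[of r "z - w0"] gw0] cutoff_nonneg[of r "z - w0"] by simp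
  have hM: "norm (h z) \<le> 2 * M" for z
    using norm_triangle_ineq4[of "g z" "cutoff r (z - w0) *\<^sub>R g w0"] cut_le[of z] bnd[of z]
    unfolding h_def by linarith
  obtain L where L: "0 \<le> L" "\<And>z. norm (h z) \<le> L * norm (z - w0)"
  proof -
    obtain \<delta> where \<delta>: "\<delta> > 0" "\<And>z. norm (z - w0) < \<delta> \<Longrightarrow> norm (g z - g w0 - g' (z - w0)) \<le> 1 * norm (z - w0)"
      using diff unfolding has_derivative_at_alt by (meson zero_less_one)
    obtain B where B: "B > 0" "\<And>x. norm (g' x) \<le> norm x * B"
      using bounded_linear.pos_bounded[OF has_derivative_bounded_linear[OF diff]] by blast
    \<comment> \<open>Near \<open>w0\<close>, \<open>1 + B\<close> bounds the increment of
      \<open>g\<close> and \<open>2 / r * M\<close> the deviation of the bump from 1; at distance at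
      least \<open>\<delta>\<close> the crude bound \<open>2 * M\<close> on \<open>h\<close> is
      absorbed by \<open>2 * M / \<delta>\<close>.\<close>
    define L where "L = 1 + B + 2 / r * M + 2 * M / \<delta>"
    have pos: "0 \<le> 2 / r * M" "0 \<le> 2 * M / \<delta>" using M r \<delta>(1) by auto
    have "norm (h z) \<le> L * norm (z - w0)" for z
    proof (cases "norm (z - w0) < \<delta>")
      case True
      have "h z = (g z - g w0 - g' (z - w0)) + g' (z - w0) - (cutoff r (z - w0) - 1) *\<^sub>R g w0"
        by (simp add: h_def algebra_simps)
      also have "norm \<dots> \<le> norm (g z - g w0 - g' (z - w0)) + norm (g' (z - w0))
          + norm ((cutoff r (z - w0) - 1) *\<^sub>R g w0)"
        by (intro order_trans[OF norm_triangle_ineq4] add_mono norm_triangle_ineq order_refl)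
      also have "\<dots> \<le> 1 * norm (z - w0) + norm (z - w0) * B + 2 / r * norm (z - w0) * M"
        unfolding norm_scaleR using \<delta>(2)[OF True] B(2) abs_cutoff_minus_1_le[OF r] gw0 r
        by (intro add_mono mult_mono) auto
      also have "\<dots> = (1 + B + 2 / r * M) * norm (z - w0)" by (simp add: algebra_simps)
      also have "\<dots> \<le> L * norm (z - w0)"
        using pos by (intro mult_right_mono) (auto simp: L_def)
      finally show ?thesis .
    next
      case False
      have "2 * M = 2 * M / \<delta> * \<delta>" using \<delta>(1) by simp
      also have "\<dots> \<le> L * norm (z - w0)"
        using False pos B(1) \<delta>(1) by (intro mult_mono) (auto simp: L_def)
      finally show ?thesis using hM[of z] by linarith
    qed
    moreover have "0 \<le> L" using pos B(1) by (simp add: L_def)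
    ultimately show ?thesis using that by blast
  qed
  define S where "S = \<bar>R\<bar> + norm w0 + r"
  have hS: "h z = 0" if "z \<notin> cball w0 S" for z
  proof -
    have "norm (z - w0) > S" using that by (simp add: dist_norm norm_minus_commute)
    moreover have "norm (z - w0) \<le> norm z + norm w0" by (rule norm_triangle_ineq4)
    ultimately have "norm z > R" "r \<le> norm (z - w0)"
      unfolding S_def using r norm_ge_zero[of w0] abs_ge_zero[of R] abs_ge_self[of R] by linarith+
    then show ?thesis using supp cutoff_eq_0[OF r] by (simp add: h_def)
  qed
  have int1: "integrable lborel (\<lambda>z. (1 / (z - w)) \<cdot> h z)" for w
  proof (rule integrable_cauchy[OF hm hM, where R="S + norm (w - w0)"])
    fix z assume "z \<notin> cball w (S + norm (w - w0))"
    then have "S < norm (z - w0)"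
      using norm_triangle_ineq4[of "z - w0" "w - w0"] by (simp add: dist_norm norm_minus_commute)
    then show "h z = 0" using hS by (simp add: dist_norm norm_minus_commute)
  qed
  have int2: "integrable lborel (\<lambda>z. (1 / (z - w0)\<^sup>2) \<cdot> h z)"
    by (rule integrable_cauchy_square[OF hm L(2) hS L(1)])
  define H where "H = (\<integral>z. (1 / (z - w0)\<^sup>2) \<cdot> h z \<partial>lborel)"
  have act_cut: "\<phi> \<cdot> g z = (complex_of_real (cutoff r (z - w0)) * \<phi>) \<cdot> g w0 + \<phi> \<cdot> h z" for \<phi> z
    unfolding h_def diff_right scaleR_right scaleR_left[symmetric] by (simp add: scaleR_conv_of_real)
  obtain A where A: "((\<lambda>w. \<integral>z. complex_of_real (cutoff r (z - w0)) / (z - w) \<partial>lborel)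
      has_derivative (\<lambda>d. A * cnj d)) (at w0)"
    using cutoff_transform_has_derivative[OF r] by blast
  have "(\<integral>z. (1 / (z - w)) \<cdot> g z \<partial>lborel) =
      (\<integral>z. complex_of_real (cutoff r (z - w0)) / (z - w) \<partial>lborel) \<cdot> g w0 + (\<integral>z. (1 / (z - w)) \<cdot> h z \<partial>lborel)" for w
  proof -
    have "(\<integral>z. (1 / (z - w)) \<cdot> g z \<partial>lborel)
        = (\<integral>z. (complex_of_real (cutoff r (z - w0)) * (1 / (z - w))) \<cdot> g w0 + (1 / (z - w)) \<cdot> h z \<partial>lborel)"
      by (intro Bochner_Integration.integral_cong refl) (rule act_cut)
    then show ?thesis
      using act_integral_left[OF integrable_cutoff_transform[OF r, of w0 w], of "g w0"] int1[of w]
      by simp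
  qed
  moreover have "((\<lambda>w. (\<integral>z. complex_of_real (cutoff r (z - w0)) / (z - w) \<partial>lborel) \<cdot> g w0
      + (\<integral>z. (1 / (z - w)) \<cdot> h z \<partial>lborel)) has_derivative (\<lambda>d. (A * cnj d) \<cdot> g w0 + d \<cdot> H)) (at w0)"
    unfolding H_def using r
    by (intro has_derivative_add bounded_linear.has_derivative[OF bounded_linear_left A]
        cauchy_transform_has_derivative_vanishing[OF hm L(2) hS L(1)]) (auto simp: S_def)
  ultimately have der: "((\<lambda>w. \<integral>z. (1 / (z - w)) \<cdot> g z \<partial>lborel) has_derivative
      (\<lambda>d. (A * cnj d) \<cdot> g w0 + d \<cdot> H)) (at w0)"
    by presburger
  let ?V = "\<lambda>\<epsilon>. {z. dist z w0 > \<epsilon> \<and> dist z w1 > \<epsilon>}"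
  have [measurable]: "?V \<epsilon> \<in> sets borel" for \<epsilon>
    by (intro borel_open open_Collect_conj open_Collect_less continuous_intros)
  \<comment> \<open>The bump part vanishes exactly for every small \<open>\<epsilon>\<close>, not
    merely in the limit: the truncated kernel times the bump changes sign under a quarter turn about
    \<open>w0\<close>.\<close>
  have pv: "(\<integral>z. indicator (?V \<epsilon>) z *\<^sub>R (1 / (z - w0)\<^sup>2) \<cdot> g z \<partial>lborel)
      = (\<integral>z. indicator (?V \<epsilon>) z *\<^sub>R (1 / (z - w0)\<^sup>2) \<cdot> h z \<partial>lborel)" if \<epsilon>: "0 < \<epsilon>" "\<epsilon> < r" for \<epsilon>
  proof -
    let ?k = "\<lambda>z. complex_of_real (indicator (?V \<epsilon>) z * cutoff r (z - w0)) / (z - w0)\<^sup>2"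
    have k: "?k (w0 + z) = (if norm z > \<epsilon> then complex_of_real (cutoff r z) / z\<^sup>2 else 0)" for z
    proof (cases "norm z < r")
      case True
      have "dist w0 w1 \<le> dist (w0 + z) w1 + norm z"
        using norm_triangle_ineq4[of "w0 + z - w1" z] by (simp add: dist_norm)
      then have "dist (w0 + z) w1 > \<epsilon>" using True \<epsilon> by (simp add: r_def)
      then show ?thesis by (simp add: indicator_def dist_norm)
    qed (use cutoff_eq_0[OF r, of z] in simp)
    have "(\<integral>z. ?k z \<partial>lborel) = (\<integral>z. ?k (w0 + z) \<partial>lborel)"
      by (rule integral_translation[symmetric]) measurable
    also have "\<dots> = 0"
      unfolding k by (rule integral_odd_rotation) (auto simp: norm_mult power_mult_distrib)
    finally have k0: "(\<integral>z. ?k z \<partial>lborel) = 0" .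
    have intk: "integrable lborel ?k"
    proof (rule Bochner_Integration.integrable_bound[where f="\<lambda>z. 1 / \<epsilon>\<^sup>2 * indicator (cball w0 r) z"])
      show "integrable lborel (\<lambda>z. 1 / \<epsilon>\<^sup>2 * indicator (cball w0 r) z :: real)"
        by (intro integrable_mult_right integrable_real_indicator emeasure_bounded_finite) simp_all
      have "norm (?k z) \<le> 1 / \<epsilon>\<^sup>2 * indicator (cball w0 r) z" for z
      proof (cases "z \<in> ?V \<epsilon> \<and> z \<in> cball w0 r")
        case True
        then have "\<epsilon>\<^sup>2 \<le> (norm (z - w0))\<^sup>2" using \<epsilon> by (intro power_mono) (auto simp: dist_norm)
        then show ?thesis
          using True \<epsilon> cutoff_le_1[of r "z - w0"] cutoff_nonneg[of r "z - w0"]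
          by (auto simp: norm_divide norm_power intro!: frac_le)
      next
        case False
        then show ?thesis
          using cutoff_eq_0[OF r, of "z - w0"] by (auto simp: indicator_def dist_norm norm_minus_commute)
      qed
      then show "AE z in lborel. norm (?k z) \<le> norm (1 / \<epsilon>\<^sup>2 * indicator (cball w0 r) z :: real)"
        unfolding real_norm_def by (intro AE_I2 order_trans[OF _ abs_ge_self])
    qed measurable
    have "indicator (?V \<epsilon>) z *\<^sub>R (1 / (z - w0)\<^sup>2) \<cdot> g z
        = ?k z \<cdot> g w0 + indicator (?V \<epsilon>) z *\<^sub>R (1 / (z - w0)\<^sup>2) \<cdot> h z" for z
      unfolding act_cut[of _ z] scaleR_add_right by (simp add: indicator_def zero_left)
    then show ?thesis
      using act_integral_left[OF intk, of "g w0"] k0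
        integrable_mult_indicator[OF _ int2, of "?V \<epsilon>"]
      by (simp add: zero_left)
  qed
  have "((\<lambda>\<epsilon>. \<integral>z. indicator (?V \<epsilon>) z *\<^sub>R (1 / (z - w0)\<^sup>2) \<cdot> g z \<partial>lborel) \<longlongrightarrow> H) (at_right 0)"
  proof (rule tendsto_at_right_sequentially[OF r])
    fix E :: "nat \<Rightarrow> real" assume E: "\<And>n. 0 < E n" "\<And>n. E n < r" "E \<longlonglongrightarrow> 0"
    have "(\<lambda>n. \<integral>z. indicator (?V (E n)) z *\<^sub>R (1 / (z - w0)\<^sup>2) \<cdot> h z \<partial>lborel) \<longlonglongrightarrow> H"
      unfolding H_def
    proof (rule integral_dominated_convergence[where w="\<lambda>z. norm ((1 / (z - w0)\<^sup>2) \<cdot> h z)"])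
      show "AE z in lborel. (\<lambda>n. indicator (?V (E n)) z *\<^sub>R (1 / (z - w0)\<^sup>2) \<cdot> h z) \<longlonglongrightarrow> (1 / (z - w0)\<^sup>2) \<cdot> h z"
        using AE_lborel_singleton[of w0] AE_lborel_singleton[of w1]
      proof eventually_elim
        case (elim z)
        then have "eventually (\<lambda>n. E n < dist z w0) sequentially" "eventually (\<lambda>n. E n < dist z w1) sequentially"
          using order_tendstoD(2)[OF E(3)] by auto
        then have "eventually (\<lambda>n. indicator (?V (E n)) z *\<^sub>R (1 / (z - w0)\<^sup>2) \<cdot> h z = (1 / (z - w0)\<^sup>2) \<cdot> h z) sequentially"
          by eventually_elim simp
        then show ?case by (rule tendsto_eventually)
      qed
    qed (use int2 in \<open>auto simp: indicator_def\<close>)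
    then show "(\<lambda>n. \<integral>z. indicator (?V (E n)) z *\<^sub>R (1 / (z - w0)\<^sup>2) \<cdot> g z \<partial>lborel) \<longlonglongrightarrow> H"
      using pv E by simp
  qed
  with der show ?thesis by (rule that)
qed

end

section \<open>The Clifford algebra and the representation formula\<close>

text \<open>\<open>cl_sign\<close> is a product of signs over pairs, hence bimultiplicative with respect to symmetric
  difference; this gives the cocycle identity behind associativity.\<close>

lemma cl_sign_prod:
  "cl_sign A B = (\<Prod>a\<in>A. \<Prod>b\<in>B. if b \<le> a then - 1 else 1)" for A B :: "'n::{finite,linorder} set"
proof -
  have fin: "finite X" for X :: "'b::finite set" by simp
  let ?S = "{(a, b). a \<in> A \<and> b \<in> B \<and> b < a}" and ?T = "(\<lambda>a. (a, a)) ` (A \<inter> B)"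
  have "(\<Prod>a\<in>A. \<Prod>b\<in>B. if b \<le> a then - 1 else 1 :: real) = (\<Prod>p\<in>A \<times> B. if snd p \<le> fst p then - 1 else 1)"
    by (simp add: prod.cartesian_product case_prod_unfold)
  also have "\<dots> = (\<Prod>p\<in>?S \<union> ?T. - 1)"
    by (intro prod.mono_neutral_cong_right) (auto simp: fin)
  also have "\<dots> = (- 1) ^ card (?S \<union> ?T)" by simp
  also have "card (?S \<union> ?T) = card ?S + card ?T"
    by (rule card_Un_disjoint) (auto simp: fin)
  also have "card ?T = card (A \<inter> B)"
    by (rule card_image) (auto simp: inj_on_def)
  finally show ?thesis by (simp add: cl_sign_def)
qed

lemma prod_sym_diff:
  fixes f :: "'a::finite \<Rightarrow> real"
  assumes "\<And>x. f x * f x = 1"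
  shows "prod f (sym_diff A B) = prod f A * prod f B"
proof -
  have fin: "finite X" for X :: "'a set" by simp
  have 1: "prod f A = prod f (A - B) * prod f (A \<inter> B)"
    by (metis fin mult.commute prod.Int_Diff)
  have 2: "prod f B = prod f (B - A) * prod f (A \<inter> B)"
    by (metis fin mult.commute prod.Int_Diff Int_commute)
  have 3: "prod f (A \<inter> B) * prod f (A \<inter> B) = 1"
    by (simp add: assms flip: prod.distrib)
  have "prod f (sym_diff A B) = prod f (A - B) * prod f (B - A)"
    by (rule prod.union_disjoint) auto
  then show ?thesis using 1 2 3 by (simp add: algebra_simps)
qed

lemma cl_sign_sq: "cl_sign A B * cl_sign A B = 1"
  by (simp add: cl_sign_def flip: power_add mult_2)

lemma cl_sign_sym_diff_left: "cl_sign (sym_diff A B) C = cl_sign A C * cl_sign B C"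
  unfolding cl_sign_prod by (rule prod_sym_diff) (auto intro!: prod.neutral simp flip: prod.distrib)

lemma cl_sign_sym_diff_right: "cl_sign C (sym_diff A B) = cl_sign C A * cl_sign C B"
  unfolding cl_sign_prod by (subst (1 2 3) prod.swap, rule prod_sym_diff)
    (auto intro!: prod.neutral simp flip: prod.distrib)

lemma sym_diff_cancel: "sym_diff A (sym_diff A B) = B"
  by auto

lemma cl_mult_nth: "(x \<odot> y) $ C = (\<Sum>A\<in>UNIV. cl_sign A (sym_diff A C) * x $ A * y $ sym_diff A C)"
proof -
  have "(if sym_diff A B = C then cl_sign A B * x $ A * y $ B else 0)
      = (if B = sym_diff A C then cl_sign A B * x $ A * y $ B else 0)" for A B
    using sym_diff_cancel[of A B] sym_diff_cancel[of A C] by auto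
  then show ?thesis unfolding cl_mult_def by simp
qed

lemma cl_mult_assoc: "(x \<odot> y) \<odot> z = x \<odot> (y \<odot> z)" for x y z :: "'n::{finite,linorder} clif"
proof (rule vec_eq_iff[THEN iffD2], rule allI)
  fix C :: "'n set"
  have "((x \<odot> y) \<odot> z) $ C = (\<Sum>D\<in>UNIV. \<Sum>A\<in>UNIV. cl_sign D (sym_diff D C) * cl_sign A (sym_diff A D) *
      (x $ A * y $ sym_diff A D * z $ sym_diff D C))"
    by (simp add: cl_mult_nth sum_distrib_left sum_distrib_right mult_ac)
  also have "\<dots> = (\<Sum>A\<in>UNIV. \<Sum>D\<in>UNIV. cl_sign D (sym_diff D C) * cl_sign A (sym_diff A D) *
      (x $ A * y $ sym_diff A D * z $ sym_diff D C))"
    by (rule sum.swap)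
  also have "\<dots> = (\<Sum>A\<in>UNIV. \<Sum>B\<in>UNIV. cl_sign A (sym_diff A C) * cl_sign B (sym_diff B (sym_diff A C)) *
      (x $ A * y $ B * z $ sym_diff B (sym_diff A C)))"
  proof (rule sum.cong[OF refl])
    fix A :: "'n set"
    show "(\<Sum>D\<in>UNIV. cl_sign D (sym_diff D C) * cl_sign A (sym_diff A D) *
        (x $ A * y $ sym_diff A D * z $ sym_diff D C))
      = (\<Sum>B\<in>UNIV. cl_sign A (sym_diff A C) * cl_sign B (sym_diff B (sym_diff A C)) *
        (x $ A * y $ B * z $ sym_diff B (sym_diff A C)))"
    proof (rule sum.reindex_bij_witness[where i="sym_diff A" and j="sym_diff A"])
      fix D :: "'n set"
      have *: "sym_diff (sym_diff A D) (sym_diff A C) = sym_diff D C" by auto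
      \<comment> \<open>Expanded by bimultiplicativity, the two sides of the cocycle identity differ
        by exactly this square.\<close>
      have "cl_sign A C * cl_sign A C = 1" by (rule cl_sign_sq)
      then have "cl_sign A (sym_diff A C) * cl_sign (sym_diff A D) (sym_diff D C)
          = cl_sign D (sym_diff D C) * cl_sign A (sym_diff A D)"
        unfolding cl_sign_sym_diff_left cl_sign_sym_diff_right by algebra
      then show "cl_sign A (sym_diff A C) * cl_sign (sym_diff A D) (sym_diff (sym_diff A D) (sym_diff A C)) *
        (x $ A * y $ sym_diff A D * z $ sym_diff (sym_diff A D) (sym_diff A C)) =
        cl_sign D (sym_diff D C) * cl_sign A (sym_diff A D) * (x $ A * y $ sym_diff A D * z $ sym_diff D C)"
        unfolding * by simp
    qed (auto simp: sym_diff_cancel)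
  qed
  also have "\<dots> = (x \<odot> (y \<odot> z)) $ C"
    by (simp add: cl_mult_nth sum_distrib_left mult_ac)
  finally show "((x \<odot> y) \<odot> z) $ C = (x \<odot> (y \<odot> z)) $ C" .
qed

lemma bounded_bilinear_cl_mult: "bounded_bilinear (cl_mult :: 'n::{finite,linorder} clif \<Rightarrow> _)"
proof -
  have "bilinear (cl_mult :: 'n clif \<Rightarrow> _)"
    unfolding bilinear_def
    by (auto intro!: linearI simp: vec_eq_iff cl_mult_nth sum_distrib_left sum.distrib algebra_simps)
  then show ?thesis by (rule bilinear_conv_bounded_bilinear[THEN iffD1])
qed

interpretation cl: bounded_bilinear "cl_mult :: 'n::{finite,linorder} clif \<Rightarrow> _"
  by (rule bounded_bilinear_cl_mult)

lemma cl_mult_one_left [simp]: "cl_one \<odot> x = x" for x :: "'n::{finite,linorder} clif"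
proof (rule vec_eq_iff[THEN iffD2], rule allI)
  fix C :: "'n set"
  have "(cl_one \<odot> x) $ C = (\<Sum>A\<in>(UNIV :: 'n set set). if A = {} then cl_sign {} C * x $ C else 0)"
    unfolding cl_mult_nth by (intro sum.cong) (auto simp: cl_one_def)
  then show "(cl_one \<odot> x) $ C = x $ C" by (simp add: cl_sign_prod)
qed

lemma cl_mult_one_right [simp]: "x \<odot> cl_one = x" for x :: "'n::{finite,linorder} clif"
proof (rule vec_eq_iff[THEN iffD2], rule allI)
  fix C :: "'n set"
  have *: "sym_diff A C = {} \<longleftrightarrow> A = C" for A by auto
  have "(x \<odot> cl_one) $ C = (\<Sum>A\<in>UNIV. if A = C then cl_sign C {} * x $ C else 0)"
    unfolding cl_mult_nth by (intro sum.cong) (auto simp: cl_one_def *)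
  then show "(x \<odot> cl_one) $ C = x $ C" by (simp add: cl_sign_prod)
qed

text \<open>\<open>cl_inv\<close> is a definite description, so exhibiting an inverse is not enough;
  uniqueness of two-sided inverses comes from associativity.\<close>

lemma cl_inv_eqI:
  assumes "x \<odot> y = cl_one" "y \<odot> x = cl_one"
  shows "cl_inv x = y"
  unfolding cl_inv_def
proof (rule the_equality)
  fix y' assume "x \<odot> y' = cl_one \<and> y' \<odot> x = cl_one"
  then have "y' = (y \<odot> x) \<odot> y'" "y = y \<odot> (x \<odot> y')" using assms by auto
  then show "y' = y" by (metis cl_mult_assoc)
qed (use assms in simp)

lemma para_expand: "para x = fst x *\<^sub>R cl_one + (\<Sum>j\<in>UNIV. snd x $ j *\<^sub>R axis {j} 1)"
proof (rule vec_eq_iff[THEN iffD2], rule allI)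
  fix C :: "'a set"
  have *: "(\<Sum>j\<in>UNIV. snd x $ j * (axis {j} 1 $ C)) = (if card C = 1 then snd x $ (THE j. C = {j}) else 0)"
  proof (cases "card C = 1")
    case True
    then obtain k where C: "C = {k}" by (auto simp: card_1_singleton_iff)
    have "(\<Sum>j\<in>UNIV. snd x $ j * (axis {j} 1 $ C)) = (\<Sum>j\<in>UNIV. if j = k then snd x $ k else 0)"
      by (intro sum.cong) (auto simp: axis_def C)
    then show ?thesis by (simp add: C)
  next
    case False
    then show ?thesis by (auto simp: axis_def intro!: sum.neutral)
  qed
  show "para x $ C = (fst x *\<^sub>R cl_one + (\<Sum>j\<in>UNIV. snd x $ j *\<^sub>R axis {j} 1)) $ C"
    using * by (auto simp: para_def cl_one_def)
qed

lemma linear_para: "linear (para :: real \<times> (real, 'n::finite) vec \<Rightarrow> 'n clif)"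
  by (rule linearI) (auto simp: para_def vec_eq_iff)

lemma cl_mult_axis:
  "axis A 1 \<odot> axis B 1 = cl_sign A B *\<^sub>R axis (sym_diff A B) 1" for A B :: "'n::{finite,linorder} set"
proof (rule vec_eq_iff[THEN iffD2], rule allI)
  fix C :: "'n set"
  have *: "sym_diff A C = B \<longleftrightarrow> C = sym_diff A B" using sym_diff_cancel[of A B] sym_diff_cancel[of A C] by auto
  have "(axis A 1 \<odot> axis B 1) $ C = (\<Sum>D\<in>UNIV. if D = A then (if C = sym_diff A B then cl_sign A B else 0) else 0)"
    unfolding cl_mult_nth by (intro sum.cong) (auto simp: axis_def *[symmetric])
  then show "(axis A 1 \<odot> axis B 1) $ C = (cl_sign A B *\<^sub>R axis (sym_diff A B) 1) $ C"
    by (simp add: axis_def)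
qed

lemma cl_one_eq_axis: "cl_one = axis {} 1"
  by (simp add: cl_one_def axis_def vec_eq_iff)

lemma para_vec_square:
  "para (0, v) \<odot> para (0, v) = - (norm v)\<^sup>2 *\<^sub>R cl_one" for v :: "(real, 'n::{finite,linorder}) vec"
proof -
  let ?t = "\<lambda>i j. (v $ i * v $ j * cl_sign {i} {j}) *\<^sub>R axis (sym_diff {i} {j}) 1 :: 'n clif"
  let ?X = "\<Sum>i\<in>UNIV. \<Sum>j\<in>UNIV. ?t i j"
  have X: "para (0, v) \<odot> para (0, v) = ?X"
    unfolding para_expand
    by (subst sum.swap) (simp add: cl.sum_left cl.sum_right cl.scaleR_left cl.scaleR_right cl_mult_axis mult_ac scaleR_sum_right)
  \<comment> \<open>Symmetrising the double sum pairs each term with its transpose: off the diagonal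
    the pair cancels by anticommutation, and on it remains twice the square of a generator.\<close>
  have "?X + ?X = ?X + (\<Sum>j\<in>UNIV. \<Sum>i\<in>UNIV. ?t i j)"
    by (subst (3) sum.swap) simp
  also have "\<dots> = (\<Sum>i\<in>UNIV. \<Sum>j\<in>UNIV. ?t i j + ?t j i)"
    by (simp add: sum.distrib)
  also have "\<dots> = (\<Sum>i\<in>UNIV. \<Sum>j\<in>UNIV. if j = i then (- 2 * (v $ i)\<^sup>2) *\<^sub>R cl_one else 0)"
  proof (intro sum.cong refl)
    fix i j :: 'n
    have *: "sym_diff {i} {j} = sym_diff {j} {i}" by auto
    show "?t i j + ?t j i = (if j = i then (- 2 * (v $ i)\<^sup>2) *\<^sub>R cl_one else 0)"
    proof (cases "i = j")
      case True
      then show ?thesis by (simp add: cl_sign_prod cl_one_eq_axis power2_eq_square vec_eq_iff axis_def)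
    next
      case False
      then have "cl_sign {i} {j} + cl_sign {j} {i} = 0" by (auto simp: cl_sign_prod)
      then have "v $ i * v $ j * cl_sign {i} {j} + v $ j * v $ i * cl_sign {j} {i} = 0"
        by (metis distrib_left mult.commute mult_zero_right)
      then show ?thesis using False unfolding *[of] by (simp flip: scaleR_left.add)
    qed
  qed
  also have "\<dots> = (- 2 * (norm v)\<^sup>2) *\<^sub>R cl_one"
  proof -
    have "(\<Sum>i\<in>UNIV. - 2 * (v $ i)\<^sup>2) = - 2 * (norm v)\<^sup>2"
      by (simp add: norm_vec_def L2_set_def sum_nonneg sum_distrib_left)
    then show ?thesis by (simp only: sum.delta' sum.delta finite UNIV_I if_True flip: scaleR_sum_left)
  qed
  finally have "2 *\<^sub>R ?X = 2 *\<^sub>R (- (norm v)\<^sup>2 *\<^sub>R cl_one)"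
    by (simp add: scaleR_2)
  then have "?X = - (norm v)\<^sup>2 *\<^sub>R cl_one"
    by (rule scaleR_left_imp_eq[rotated]) simp
  then show ?thesis unfolding X .
qed

section \<open>Complex slices and the representation formula for the kernels\<close>

definition slice_emb :: "(real, 'n) vec \<Rightarrow> complex \<Rightarrow> 'n::{finite,linorder} clif"
  where "slice_emb J z = Re z *\<^sub>R cl_one + Im z *\<^sub>R para (0, J)"

text \<open>For unit \<open>J\<close> and \<open>I\<close>, the map x \<mapsto> (x - J x I)/2
  projects onto the solutions of J x = x I; this element is the image of 1. It is the coefficient (1
  - J I)/2 of the classical representation formula for slice functions.\<close>

definition slice_proj :: "(real, 'n) vec \<Rightarrow> (real, 'n) vec \<Rightarrow> 'n::{finite,linorder} clif"
  where "slice_proj J I = (1 / 2) *\<^sub>R (cl_one - para (0, J) \<odot> para (0, I))"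

lemma unit_sph_square: "J \<in> unit_sph \<Longrightarrow> para (0, J) \<odot> para (0, J) = - cl_one"
  by (simp add: para_vec_square unit_sph_def)

lemma para_uminus_vec: "para (0, - J) = - para (0, J)"
  using linear_neg[OF linear_para, of "(0, J)"] by simp

lemma slice_emb_uminus: "slice_emb (- J) z = slice_emb J (cnj z)"
  by (simp add: slice_emb_def para_uminus_vec)

lemma slice_emb_1 [simp]: "slice_emb J 1 = cl_one"
  by (simp add: slice_emb_def)

lemma slice_emb_of_real: "slice_emb J (complex_of_real r) = r *\<^sub>R cl_one"
  by (simp add: slice_emb_def)

lemma slice_emb_mult: "J \<in> unit_sph \<Longrightarrow> slice_emb J z \<odot> slice_emb J w = slice_emb J (z * w)"
  by (simp add: slice_emb_def cl.add_left cl.add_right cl.scaleR_left cl.scaleR_right unit_sph_square algebra_simps)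

lemma slice_emb_add: "slice_emb J (z + w) = slice_emb J z + slice_emb J w"
  and slice_emb_diff: "slice_emb J (z - w) = slice_emb J z - slice_emb J w"
  and slice_emb_minus: "slice_emb J (- z) = - slice_emb J z"
  and slice_emb_scaleR: "slice_emb J (r *\<^sub>R z) = r *\<^sub>R slice_emb J z"
  by (simp_all add: slice_emb_def algebra_simps)

lemma slice_emb_inverse:
  assumes "J \<in> unit_sph" "z \<noteq> 0"
  shows "cl_inv (slice_emb J z) = slice_emb J (1 / z)"
  using assms by (intro cl_inv_eqI) (simp_all add: slice_emb_mult)

text \<open>Both J (1 - J I) and (1 - J I) I equal J + I. The identity carries a complex scalar from
  the slice of \<open>J\<close> over to the slice of \<open>I\<close>.\<close>

lemma slice_emb_slice_proj:
  assumes "J \<in> unit_sph" "I \<in> unit_sph"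
  shows "slice_emb J z \<odot> slice_proj J I = slice_proj J I \<odot> slice_emb I z"
proof -
  have "para (0, J) \<odot> (para (0, J) \<odot> para (0, I)) = - para (0, I)"
    "(para (0, J) \<odot> para (0, I)) \<odot> para (0, I) = - para (0, J)"
    by (simp_all add: unit_sph_square[OF assms(1)] cl.minus_left flip: cl_mult_assoc)
      (simp add: unit_sph_square[OF assms(2)] cl.minus_right cl_mult_assoc)
  then show ?thesis
    by (simp add: slice_emb_def slice_proj_def cl.add_left cl.add_right cl.diff_left cl.diff_right
        cl.scaleR_left cl.scaleR_right algebra_simps)
qed

lemma slice_proj_add: "slice_proj J I + slice_proj J (- I) = cl_one"
  by (simp add: slice_proj_def para_uminus_vec cl.minus_right flip: scaleR_right.add scaleR_2)

text \<open>The unit is inserted as the sum of the coefficients for \<open>I\<close> and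
  \<open>- I\<close>, and \<open>z\<close> is moved through each. On the second summand it arrives
  in the slice of \<open>- I\<close>, where it is the conjugate of \<open>z\<close> read in the
  slice of \<open>I\<close>.\<close>

lemma slice_emb_representation:
  assumes "J \<in> unit_sph" "I \<in> unit_sph"
  shows "slice_emb J z \<odot> slice_emb I w =
    slice_proj J I \<odot> slice_emb I (z * w) + slice_proj J (- I) \<odot> slice_emb I (cnj z * w)"
proof -
  have "- I \<in> unit_sph" using assms by (simp add: unit_sph_def)
  have "slice_emb J z = slice_emb J z \<odot> (slice_proj J I + slice_proj J (- I))"
    by (simp add: slice_proj_add)
  also have "\<dots> = slice_proj J I \<odot> slice_emb I z + slice_proj J (- I) \<odot> slice_emb I (cnj z)"
    using slice_emb_slice_proj[OF assms(1,2)] slice_emb_slice_proj[OF assms(1) \<open>- I \<in> unit_sph\<close>]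
    by (simp add: cl.add_right slice_emb_uminus)
  finally show ?thesis
    using assms by (simp add: cl.add_left cl_mult_assoc slice_emb_mult)
qed

lemma fst_slice_pt [simp]: "fst (slice_pt J p) = fst p"
  by (simp add: slice_pt_def)

lemma para_slice_pt:
  "para (slice_pt J p) = slice_emb J (Complex (fst p) (snd p))" for J :: "(real, 'n::{finite,linorder}) vec"
proof -
  have "slice_pt J p = fst p *\<^sub>R (1, 0) + snd p *\<^sub>R (0, J)" by (simp add: slice_pt_def)
  moreover have "para (1, 0 :: (real, 'n) vec) = cl_one" by (simp add: para_expand)
  ultimately show ?thesis
    by (simp add: slice_emb_def linear_add[OF linear_para] linear_scale[OF linear_para] del: scaleR_Pair)
qed

lemma cl_conj_slice_emb: "cl_conj (slice_emb J z) = slice_emb J (cnj z)"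
proof -
  have "cl_conj (para (slice_pt J (Re z, Im z))) = para (slice_pt J (Re z, - Im z))"
    by (auto simp: cl_conj_def para_def slice_pt_def vec_eq_iff)
  then show ?thesis by (simp add: para_slice_pt complex_cnj[symmetric])
qed

context
  fixes J I :: "(real, 'n::{finite,linorder}) vec" and z x :: complex
  assumes J: "J \<in> unit_sph" and I: "I \<in> unit_sph" and ne: "x \<noteq> z" "x \<noteq> cnj z"
begin

text \<open>The point \<open>x\<close> enters the polynomial only through its real part and norm. So
  everything stays in the slice of \<open>J\<close>, whatever \<open>I\<close> is, and can be
  factored and inverted as a complex number; its zeros are the two points excluded by
  \<open>ne\<close>.\<close>

lemma cl_inv_char_poly_slice:
  "cl_inv (char_poly (slice_pt J (Re z, Im z)) (slice_pt I (Re x, Im x)))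
    = slice_emb J (1 / ((z - x) * (z - cnj x)))"
proof -
  have n: "(norm (slice_pt I (Re x, Im x)))\<^sup>2 = (norm x)\<^sup>2"
    using I by (simp add: slice_pt_def norm_Pair unit_sph_def cmod_power2)
  have "char_poly (slice_pt J (Re z, Im z)) (slice_pt I (Re x, Im x))
      = slice_emb J (z * z - (2 * Re x) *\<^sub>R z + complex_of_real ((norm x)\<^sup>2))"
    unfolding char_poly_def n slice_emb_add slice_emb_diff slice_emb_scaleR
    using J by (simp add: para_slice_pt slice_emb_mult cl_scalar_def slice_emb_of_real del: of_real_power)
  also have "z * z - (2 * Re x) *\<^sub>R z + complex_of_real ((norm x)\<^sup>2) = (z - x) * (z - cnj x)"
    by (simp add: complex_eq_iff cmod_power2) (simp add: power2_eq_square algebra_simps)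
  finally have *: "char_poly (slice_pt J (Re z, Im z)) (slice_pt I (Re x, Im x)) = slice_emb J ((z - x) * (z - cnj x))" .
  have "(z - x) * (z - cnj x) \<noteq> 0" using ne by auto
  then show ?thesis unfolding * by (rule slice_emb_inverse[OF J])
qed

lemma slice_cauchy_representation:
  "slice_cauchy (slice_pt J (Re z, Im z)) (slice_pt I (Re x, Im x))
    = slice_proj J I \<odot> slice_emb I (1 / (x - z)) + slice_proj J (- I) \<odot> slice_emb I (1 / (x - cnj z))"
proof -
  let ?c = "1 / ((z - x) * (z - cnj x))"
  have ne': "cnj x \<noteq> z" "cnj x \<noteq> cnj z" using ne by auto
  have "slice_cauchy (slice_pt J (Re z, Im z)) (slice_pt I (Re x, Im x))
      = - (slice_emb J (?c * z) \<odot> slice_emb I 1 - slice_emb J ?c \<odot> slice_emb I (cnj x))"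
    unfolding slice_cauchy_def cl_inv_char_poly_slice
    using J by (simp add: para_slice_pt cl_conj_slice_emb cl.diff_right slice_emb_mult)
  also have "\<dots> = slice_proj J I \<odot> slice_emb I (- (?c * z * 1 - ?c * cnj x))
      + slice_proj J (- I) \<odot> slice_emb I (- (cnj (?c * z) * 1 - cnj ?c * cnj x))"
    unfolding slice_emb_representation[OF J I] slice_emb_diff slice_emb_minus cl.minus_right cl.diff_right
    by simp
  \<comment> \<open>The factor \<open>z - cnj x\<close> of the denominator cancels, leaving an
    ordinary planar Cauchy kernel.\<close>
  also have "- (?c * z * 1 - ?c * cnj x) = 1 / (x - z)"
    using ne ne' by (simp add: divide_simps)
  also have "- (cnj (?c * z) * 1 - cnj ?c * cnj x) = 1 / (x - cnj z)"
    using ne ne' by (simp add: divide_simps)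
  finally show ?thesis .
qed

text \<open>In the star-square all powers of \<open>q\<close> stand to the left of those of the
  conjugate of \<open>x\<close>. The representation formula applies termwise, and on each of the two
  summands the expansion becomes a genuine complex square.\<close>

lemma kernel2_representation:
  "kernel2 (slice_pt J (Re z, Im z)) (slice_pt I (Re x, Im x))
    = slice_proj J I \<odot> slice_emb I (1 / (x - z)\<^sup>2) + slice_proj J (- I) \<odot> slice_emb I (1 / (x - cnj z)\<^sup>2)"
proof -
  let ?c = "1 / ((z - x) * (z - cnj x))"
  have ne': "cnj x \<noteq> z" "cnj x \<noteq> cnj z" using ne by auto
  have "kernel2 (slice_pt J (Re z, Im z)) (slice_pt I (Re x, Im x))
      = slice_emb J (?c * ?c * (z * z)) \<odot> slice_emb I 1
        - 2 *\<^sub>R (slice_emb J (?c * ?c * z) \<odot> slice_emb I (cnj x))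
        + slice_emb J (?c * ?c) \<odot> slice_emb I (cnj x * cnj x)"
    unfolding kernel2_def cl_inv_char_poly_slice
    using J I by (simp add: para_slice_pt cl_conj_slice_emb cl.diff_right cl.add_right cl.scaleR_right
        slice_emb_mult flip: cl_mult_assoc)
  also have "\<dots> = slice_proj J I \<odot> slice_emb I (?c * ?c * (z * z) * 1 - 2 *\<^sub>R (?c * ?c * z * cnj x) + ?c * ?c * (cnj x * cnj x))
      + slice_proj J (- I) \<odot> slice_emb I (cnj (?c * ?c * (z * z)) * 1 - 2 *\<^sub>R (cnj (?c * ?c * z) * cnj x)
         + cnj (?c * ?c) * (cnj x * cnj x))"
    unfolding slice_emb_representation[OF J I] slice_emb_diff slice_emb_add slice_emb_scaleR
      cl.add_right cl.diff_right cl.scaleR_right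
    by (simp add: algebra_simps)
  also have "?c * ?c * (z * z) * 1 - 2 *\<^sub>R (?c * ?c * z * cnj x) + ?c * ?c * (cnj x * cnj x) = 1 / (x - z)\<^sup>2"
  proof -
    have "?c * ?c * (z * z) * 1 - 2 *\<^sub>R (?c * ?c * z * cnj x) + ?c * ?c * (cnj x * cnj x) = (?c * (z - cnj x))\<^sup>2"
      by (simp only: power2_eq_square scaleR_conv_of_real) (simp only: of_real_numeral, algebra)
    also have "?c * (z - cnj x) = - (1 / (x - z))"
      using ne ne' by (simp add: divide_simps) 
    finally show ?thesis by (simp add: power_divide)
  qed
  also have "cnj (?c * ?c * (z * z)) * 1 - 2 *\<^sub>R (cnj (?c * ?c * z) * cnj x) + cnj (?c * ?c) * (cnj x * cnj x)
      = 1 / (x - cnj z)\<^sup>2"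
  proof -
    have "cnj (?c * ?c * (z * z)) * 1 - 2 *\<^sub>R (cnj (?c * ?c * z) * cnj x) + cnj (?c * ?c) * (cnj x * cnj x)
        = (cnj ?c * (cnj z - cnj x))\<^sup>2"
      by (simp only: power2_eq_square scaleR_conv_of_real complex_cnj_mult) (simp only: of_real_numeral, algebra)
    also have "cnj ?c * (cnj z - cnj x) = - (1 / (x - cnj z))"
      using ne ne' by (simp add: divide_simps)
    finally show ?thesis by (simp add: power_divide)
  qed
  finally show ?thesis .
qed

end

lemma complex_action_slice_emb:
  assumes "I \<in> unit_sph"
  shows "complex_action (\<lambda>z x. slice_emb I z \<odot> x)"
proof -
  have "bounded_linear (slice_emb I)"
    by (auto intro!: linearI simp: slice_emb_add slice_emb_scaleR simp flip: linear_conv_bounded_linear)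
  then interpret bounded_bilinear "\<lambda>z x. slice_emb I z \<odot> x"
    by (rule bounded_bilinear.comp1[OF bounded_bilinear_cl_mult])
  show ?thesis
    by unfold_locales (use assms in \<open>auto simp: cl_mult_assoc simp flip: slice_emb_mult\<close>)
qed

section \<open>Transfer of integrals from real pairs to the complex plane\<close>

lemma lborel_distr_Complex: "distr lborel borel (\<lambda>p. Complex (fst p) (snd p)) = lborel"
proof (rule lborel_eqI[symmetric])
  fix l u :: complex assume le: "\<And>b. b \<in> Basis \<Longrightarrow> l \<bullet> b \<le> u \<bullet> b"
  have [measurable]: "(\<lambda>p. Complex (fst p) (snd p)) \<in> borel_measurable borel"
    by (intro borel_measurable_continuous_onI continuous_intros)
  have *: "Re l \<le> Re u" "Im l \<le> Im u" using le[of 1] le[of \<i>] by (auto simp: Basis_complex_def)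
  have "(\<lambda>p. Complex (fst p) (snd p)) -` box l u = box (Re l, Im l) (Re u, Im u)"
    by (auto simp: box_def Basis_complex_def Basis_prod_def)
  then show "emeasure (distr lborel borel (\<lambda>p. Complex (fst p) (snd p))) (box l u) = (\<Prod>b\<in>Basis. (u - l) \<bullet> b)"
    using * by (simp add: emeasure_distr emeasure_lborel_box_eq Basis_complex_def Basis_prod_def)
qed simp

lemma integral_plane_eq_lborel:
  fixes G :: "complex \<Rightarrow> 'b::euclidean_space"
  assumes G: "integrable lborel G" and N: "finite N"
    and eq: "\<And>p. Complex (fst p) (snd p) \<notin> N \<Longrightarrow> G (Complex (fst p) (snd p)) = (if p \<in> S then \<phi> p else 0)"
  shows "integral S \<phi> = (\<integral>z. G z \<partial>lborel)"
proof -
  let ?c = "\<lambda>p. Complex (fst p) (snd p)"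
  have [measurable]: "?c \<in> borel_measurable borel"
    by (intro borel_measurable_continuous_onI continuous_intros)
  have [measurable]: "G \<in> borel_measurable borel" using G by auto
  have int: "integrable lborel (\<lambda>p. G (?c p))"
    using G by (subst integrable_distr_eq[of ?c lborel borel G, symmetric]) (auto simp: lborel_distr_Complex)
  have "integral S \<phi> = integral UNIV (\<lambda>p. if p \<in> S then \<phi> p else 0)"
    by (simp add: integral_restrict_UNIV)
  also have "\<dots> = integral UNIV (\<lambda>p. G (?c p))"
  proof (rule integral_spike[where S="(\<lambda>z. (Re z, Im z)) ` N"])
    show "negligible ((\<lambda>z. (Re z, Im z)) ` N)" using N by (intro negligible_finite) simp
    show "G (?c p) = (if p \<in> S then \<phi> p else 0)" if "p \<in> UNIV - (\<lambda>z. (Re z, Im z)) ` N" for p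
      using that by (intro eq) force
  qed
  also have "\<dots> = (\<integral>p. G (?c p) \<partial>lborel)"
    by (rule integral_lborel[OF int])
  also have "\<dots> = (\<integral>z. G z \<partial>lborel)"
    by (subst lborel_distr_Complex[symmetric], subst integral_distr) auto
  finally show ?thesis .
qed

section \<open>Differentiation along slices\<close>

definition axis_dir :: "real \<times> (real, 'n) vec \<Rightarrow> (real, 'n::finite) vec"
  where "axis_dir q = (1 / norm (snd q)) *\<^sub>R snd q"

text \<open>Together with \<open>axis_dir\<close> this gives polar coordinates q = x_0 + J r with r
  = |q_vec|; the representing complex number always lies in the closed upper half-plane.\<close>

definition slice_coord :: "real \<times> (real, 'n::finite) vec \<Rightarrow> complex"
  where "slice_coord q = Complex (fst q) (norm (snd q))"

lemma axis_dir_unit: "snd q \<noteq> 0 \<Longrightarrow> axis_dir q \<in> unit_sph"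
  by (simp add: axis_dir_def unit_sph_def)

lemma slice_pt_axis_dir:
  "snd q \<noteq> 0 \<Longrightarrow> slice_pt (axis_dir q) (Re (slice_coord q), Im (slice_coord q)) = q"
  by (simp add: slice_pt_def axis_dir_def slice_coord_def prod_eq_iff)

lemma has_vector_derivative_along:
  assumes "(F has_derivative D) (at x)"
  shows "((\<lambda>t. F (x + t *\<^sub>R v)) has_vector_derivative D v) (at 0)"
proof -
  have "((\<lambda>t. x + t *\<^sub>R v) has_derivative (\<lambda>t. t *\<^sub>R v)) (at 0)"
    by (auto intro!: derivative_eq_intros)
  from has_derivative_compose[OF this, of F D] assms
  have "((\<lambda>t. F (x + t *\<^sub>R v)) has_derivative (\<lambda>t. D (t *\<^sub>R v))) (at 0)" by simp
  then show ?thesis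
    using linear_scale[OF has_derivative_linear[OF assms]] by (simp add: has_vector_derivative_def)
qed

lemma slice_proj_axis_dir_differentiable:
  fixes I :: "(real, 'n::{finite,linorder}) vec"
  assumes "snd q \<noteq> 0"
  shows "(\<lambda>q. slice_proj (axis_dir q) I) differentiable (at q)"
proof -
  have lin: "linear (\<lambda>J. para (0, J) \<odot> para (0, I))"
  proof (rule linearI)
    fix a b :: "(real, 'n) vec" and r :: real
    show "para (0, a + b) \<odot> para (0, I) = para (0, a) \<odot> para (0, I) + para (0, b) \<odot> para (0, I)"
      using linear_add[OF linear_para, of "(0, a)" "(0, b)"] by (simp add: cl.add_left)
    show "para (0, r *\<^sub>R a) \<odot> para (0, I) = r *\<^sub>R (para (0, a) \<odot> para (0, I))"
      using linear_scale[OF linear_para, of r "(0, a)"] by (simp add: cl.scaleR_left)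
  qed
  have snd: "((\<lambda>q :: real \<times> (real, 'n) vec. snd q) has_derivative snd) (at q)"
    by (intro derivative_eq_intros) auto
  obtain N where N: "(norm has_derivative N) (at (snd q))"
    using differentiable_norm_at[OF assms] by (auto simp: differentiable_def)
  have "((\<lambda>q. axis_dir q) has_derivative
      (\<lambda>h. (1 / norm (snd q)) *\<^sub>R snd h + (- N (snd h) / (norm (snd q))\<^sup>2) *\<^sub>R snd q)) (at q)"
    unfolding axis_dir_def using assms
    by (auto intro!: derivative_eq_intros has_derivative_compose[OF snd N] simp: power2_eq_square)
  from bounded_linear.has_derivative[OF linear_conv_bounded_linear[THEN iffD1, OF lin] this]
  show ?thesis
    unfolding slice_proj_def by (intro derivative_intros) (auto simp: differentiable_def)
qed

text \<open>Along the ray through \<open>q\<close> the direction is constant, so the Euler operator in \<open>Gbar\<close> only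
  sees the radial derivative.\<close>

lemma Gbar_slice_combination:
  fixes I :: "(real, 'n::{finite,linorder}) vec" and F :: "complex \<Rightarrow> 'n clif"
  assumes q: "snd q \<noteq> 0" and I: "I \<in> unit_sph"
    and F1: "(F has_derivative F1) (at (slice_coord q))"
    and F2: "(F has_derivative F2) (at (cnj (slice_coord q)))"
    and h: "\<And>q. snd q \<noteq> 0 \<Longrightarrow> h q = c *\<^sub>R (slice_proj (axis_dir q) I \<odot> F (slice_coord q)
      + slice_proj (axis_dir q) (- I) \<odot> F (cnj (slice_coord q)))"
  shows "Gbar h q = c *\<^sub>R (slice_proj (axis_dir q) I \<odot> (F1 1 - slice_emb I \<i> \<odot> F1 \<i>)
      + slice_proj (axis_dir q) (- I) \<odot> (F2 1 - slice_emb I \<i> \<odot> F2 \<i>))"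
proof -
  let ?P = "slice_proj (axis_dir q) I" and ?M = "slice_proj (axis_dir q) (- I)"
  let ?r = "norm (snd q)" and ?\<zeta> = "slice_coord q"
  have r: "?r > 0" using q by simp
  have lin1: "linear F1" and lin2: "linear F2"
    using F1 F2 has_derivative_linear by blast+
  \<comment> \<open>Only the existence of a total derivative matters. It lets the weighted sum of
    partial derivatives be read as \<open>D (0, snd q)\<close>; the values of \<open>D\<close> come
    from two lines along which the direction is constant.\<close>
  obtain D where D: "(h has_derivative D) (at q)"
  proof -
    have snd: "((\<lambda>q :: real \<times> (real, 'n) vec. snd q) has_derivative snd) (at q)"
      by (intro derivative_eq_intros) auto
    obtain N where N: "(norm has_derivative N) (at (snd q))"
      using differentiable_norm_at[OF q] by (auto simp: differentiable_def)
    have *: "slice_coord = (\<lambda>q :: real \<times> (real, 'n) vec. fst q *\<^sub>R 1 + norm (snd q) *\<^sub>R \<i>)"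
      by (auto simp: slice_coord_def complex_eq_iff)
    have Z: "(slice_coord has_derivative (\<lambda>h. fst h *\<^sub>R 1 + N (snd h) *\<^sub>R \<i>)) (at q)"
      unfolding *
      by (intro has_derivative_add has_derivative_scaleR_left has_derivative_compose[OF snd N]
          has_derivative_fst has_derivative_ident)
    have d1: "(\<lambda>q. F (slice_coord q)) differentiable (at q)"
      using has_derivative_compose[OF Z F1] by (auto simp: differentiable_def)
    have d2: "(\<lambda>q. F (cnj (slice_coord q))) differentiable (at q)"
      using has_derivative_compose[OF has_derivative_cnj[OF Z] F2] by (auto simp: differentiable_def)
    have mult: "(\<lambda>q. u q \<odot> v q) differentiable (at q)"
      if "u differentiable (at q)" "v differentiable (at q)" for u v :: "real \<times> (real, 'n) vec \<Rightarrow> 'n clif"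
      using that cl.FDERIV unfolding differentiable_def by blast
    have "(\<lambda>q. c *\<^sub>R (slice_proj (axis_dir q) I \<odot> F (slice_coord q)
        + slice_proj (axis_dir q) (- I) \<odot> F (cnj (slice_coord q)))) differentiable (at q)"
      by (intro derivative_intros mult d1 d2 slice_proj_axis_dir_differentiable q)
    then obtain D where "((\<lambda>q. c *\<^sub>R (slice_proj (axis_dir q) I \<odot> F (slice_coord q)
        + slice_proj (axis_dir q) (- I) \<odot> F (cnj (slice_coord q)))) has_derivative D) (at q)"
      by (auto simp: differentiable_def)
    moreover have "open {q :: real \<times> (real, 'n) vec. snd q \<noteq> 0}"
      by (intro open_Collect_neq continuous_intros)
    ultimately have "(h has_derivative D) (at q)"
      by (rule has_derivative_transform_within_open) (use q h in auto)
    then show ?thesis by (rule that)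
  qed
  have curve: "((\<lambda>t. c *\<^sub>R (?P \<odot> F (?\<zeta> + t *\<^sub>R v) + ?M \<odot> F (cnj ?\<zeta> + t *\<^sub>R w)))
      has_vector_derivative c *\<^sub>R (?P \<odot> F1 v + ?M \<odot> F2 w)) (at 0)" for v w
    by (intro bounded_linear.has_vector_derivative[OF bounded_linear_scaleR_right]
        bounded_linear.has_vector_derivative[OF cl.bounded_linear_right]
        has_vector_derivative_add has_vector_derivative_along F1 F2)
  have D0: "D (1, 0) = c *\<^sub>R (?P \<odot> F1 1 + ?M \<odot> F2 1)"
  proof (rule vector_derivative_unique_at[OF has_vector_derivative_along[OF D]])
    have "h (q + t *\<^sub>R (1, 0)) = c *\<^sub>R (?P \<odot> F (?\<zeta> + t *\<^sub>R 1) + ?M \<odot> F (cnj ?\<zeta> + t *\<^sub>R 1))" for t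
    proof -
      have "slice_coord (q + t *\<^sub>R (1, 0)) = ?\<zeta> + t *\<^sub>R 1"
        by (simp add: slice_coord_def complex_eq_iff)
      moreover have "axis_dir (q + t *\<^sub>R (1, 0)) = axis_dir q" by (simp add: axis_dir_def)
      ultimately show ?thesis using q by (subst h) (simp_all add: scaleR_conv_of_real)
    qed
    then show "((\<lambda>t. h (q + t *\<^sub>R (1, 0))) has_vector_derivative c *\<^sub>R (?P \<odot> F1 1 + ?M \<odot> F2 1)) (at 0)"
      using curve by simp
  qed
  have Dr: "D (0, snd q) = c *\<^sub>R (?P \<odot> F1 (?r *\<^sub>R \<i>) + ?M \<odot> F2 (- ?r *\<^sub>R \<i>))"
  proof (rule vector_derivative_unique_at[OF has_vector_derivative_along[OF D]])
    \<comment> \<open>On this interval \<open>1 + t\<close> is positive, so moving along the ray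
      changes neither the direction nor the side of the real axis.\<close>
    have "c *\<^sub>R (?P \<odot> F (?\<zeta> + t *\<^sub>R ?r *\<^sub>R \<i>) + ?M \<odot> F (cnj ?\<zeta> + t *\<^sub>R (- ?r *\<^sub>R \<i>))) = h (q + t *\<^sub>R (0, snd q))"
      if "t \<in> {-1<..<1}" for t :: real
    proof -
      have s: "snd (q + t *\<^sub>R (0, snd q)) = (1 + t) *\<^sub>R snd q" by (simp add: algebra_simps)
      then have n: "norm (snd (q + t *\<^sub>R (0, snd q))) = (1 + t) * ?r" using that by simp
      have "slice_coord (q + t *\<^sub>R (0, snd q)) = ?\<zeta> + t *\<^sub>R ?r *\<^sub>R \<i>"
        unfolding slice_coord_def n by (simp add: complex_eq_iff algebra_simps)
      moreover have "axis_dir (q + t *\<^sub>R (0, snd q)) = axis_dir q"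
        unfolding axis_dir_def n using that by (subst s) simp
      moreover have "cnj (?\<zeta> + t *\<^sub>R ?r *\<^sub>R \<i>) = cnj ?\<zeta> + t *\<^sub>R (- ?r *\<^sub>R \<i>)"
        by (simp add: complex_eq_iff)
      ultimately show ?thesis using q that s by (subst h) auto
    qed
    then show "((\<lambda>t. h (q + t *\<^sub>R (0, snd q))) has_vector_derivative
        c *\<^sub>R (?P \<odot> F1 (?r *\<^sub>R \<i>) + ?M \<odot> F2 (- ?r *\<^sub>R \<i>))) (at 0)"
      using has_vector_derivative_transform_within_open[OF curve, where S="{-1<..<1}"] by simp
  qed
  have "(\<Sum>j\<in>UNIV. snd q $ j *\<^sub>R D (0, axis j 1)) = D (0, snd q)"
  proof -
    have lin: "linear (\<lambda>v. D (0, v))"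
    proof (rule linearI)
      show "D (0, a + b) = D (0, a) + D (0, b)" for a b
        using linear_add[OF has_derivative_linear[OF D], of "(0, a)" "(0, b)"] by simp
      show "D (0, r *\<^sub>R a) = r *\<^sub>R D (0, a)" for r a
        using linear_scale[OF has_derivative_linear[OF D], of r "(0, a)"] by simp
    qed
    have "(\<Sum>j\<in>UNIV. snd q $ j *\<^sub>R D (0, axis j 1)) = D (0, \<Sum>j\<in>UNIV. snd q $ j *\<^sub>R axis j 1)"
      by (simp add: linear_sum[OF lin] linear_scale[OF lin])
    also have "(\<Sum>j\<in>UNIV. snd q $ j *\<^sub>R axis j 1) = snd q"
      using basis_expansion[of "snd q"] by (simp add: scalar_mult_eq_scaleR)
    finally show ?thesis .
  qed
  moreover have "vector_derivative (\<lambda>t. h (q + (0, t *\<^sub>R axis j 1))) (at 0) = D (0, axis j 1)" for j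
    using vector_derivative_at[OF has_vector_derivative_along[OF D, of "(0, axis j 1)"]] by simp
  moreover have "vector_derivative (\<lambda>t. h (q + (t, 0))) (at 0) = D (1, 0)"
    using vector_derivative_at[OF has_vector_derivative_along[OF D, of "(1, 0)"]] by simp
  ultimately have G: "Gbar h q = D (1, 0) - ((1 / ?r\<^sup>2) *\<^sub>R para (0, snd q)) \<odot> D (0, snd q)"
    by (simp add: Gbar_def)
  have w: "(1 / ?r\<^sup>2) *\<^sub>R para (0, snd q) = (1 / ?r) *\<^sub>R slice_emb (axis_dir q) \<i>"
    using linear_scale[OF linear_para, of "1 / ?r" "(0, snd q)"]
    by (simp add: slice_emb_def axis_dir_def power2_eq_square)
  have P: "slice_emb (axis_dir q) \<i> \<odot> (?P \<odot> x) = ?P \<odot> (slice_emb I \<i> \<odot> x)" for x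
    using slice_emb_slice_proj[OF axis_dir_unit[OF q] I, of \<i>] by (simp flip: cl_mult_assoc)
  \<comment> \<open>The sign here compensates the one in \<open>F2 (- ?r *\<^sub>R \<i>)\<close>,
    which arises because the conjugate point moves downwards as the radius grows. Both summands thus
    end with the same Wirtinger combination.\<close>
  have M: "slice_emb (axis_dir q) \<i> \<odot> (?M \<odot> x) = - (?M \<odot> (slice_emb I \<i> \<odot> x))" for x
  proof -
    have "- I \<in> unit_sph" using I by (simp add: unit_sph_def)
    from slice_emb_slice_proj[OF axis_dir_unit[OF q] this, of \<i>]
    show ?thesis
      by (simp add: slice_emb_uminus slice_emb_minus cl.minus_left cl.minus_right flip: cl_mult_assoc)
  qed
  show ?thesis
    unfolding G D0 Dr w using r
    by (simp add: cl.add_right cl.diff_right cl.scaleR_left cl.scaleR_right cl.minus_right P M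
        linear_scale[OF lin1] linear_scale[OF lin2] linear_neg[OF lin2] scaleR_add_right scaleR_diff_right)
qed

text \<open>The planar lemma wants a density on the whole plane. Extension by zero suffices, because
  differentiability is claimed only at points of the open slice domain; continuity up to the compact
  closure supplies the bound.\<close>

lemma slice_extension:
  fixes f :: "real \<times> (real, 'n) vec \<Rightarrow> 'n::{finite,linorder} clif"
  assumes "open \<Omega>" "bounded \<Omega>" and I: "I \<in> unit_sph"
    and C1: "C1_closure (slice_dom \<Omega> I) (\<lambda>p. f (slice_pt I p))"
  obtains g :: "complex \<Rightarrow> 'n clif" and M R where
    "g \<in> borel_measurable borel" "\<And>z. norm (g z) \<le> M" "\<And>z. z \<notin> cball 0 R \<Longrightarrow> g z = 0"
    "\<And>p. g (Complex (fst p) (snd p)) = (if p \<in> slice_dom \<Omega> I then f (slice_pt I p) else 0)"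
    "\<And>p. p \<in> slice_dom \<Omega> I \<Longrightarrow> g differentiable (at (Complex (fst p) (snd p)))"
proof -
  let ?U = "slice_dom \<Omega> I"
  define \<phi> where "\<phi> p = f (slice_pt I p)" for p
  have norm_slice: "norm (slice_pt I p) = norm p" for p
    using I by (cases p) (simp add: slice_pt_def norm_Pair unit_sph_def)
  have "slice_dom \<Omega> I = slice_pt I -` \<Omega>" by (auto simp: slice_dom_def)
  moreover have "continuous_on UNIV (slice_pt I)"
    unfolding slice_pt_def[abs_def] by (intro continuous_intros)
  ultimately have oU: "open ?U"
    using \<open>open \<Omega>\<close> by (metis open_vimage)
  obtain R where R: "\<And>x. x \<in> \<Omega> \<Longrightarrow> norm x \<le> R" using \<open>bounded \<Omega>\<close> by (auto simp: bounded_iff)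
  have RU: "norm p \<le> R" if "p \<in> ?U" for p
    using R[of "slice_pt I p"] that by (simp add: slice_dom_def norm_slice)
  then have bU: "bounded ?U" unfolding bounded_iff by blast
  have cont: "continuous_on (closure ?U) \<phi>"
    using C1 unfolding C1_closure_def \<phi>_def by blast
  have "bounded (\<phi> ` closure ?U)"
    using bU cont by (intro compact_imp_bounded compact_continuous_image) (auto simp: compact_closure)
  then obtain M0 where M0: "\<And>p. p \<in> closure ?U \<Longrightarrow> norm (\<phi> p) \<le> M0"
    unfolding bounded_iff by blast
  let ?c = "\<lambda>z. (Re z, Im z)"
  let ?V = "?c -` ?U"
  define g where "g z = indicator ?V z *\<^sub>R \<phi> (?c z)" for z
  have oV: "open ?V"
    by (intro open_vimage oU continuous_intros)
  show ?thesis
  proof (rule that[of g "\<bar>M0\<bar>" R])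
    show "g \<in> borel_measurable borel"
      unfolding g_def[abs_def]
    proof (rule borel_measurable_continuous_on_indicator)
      show "continuous_on ?V (\<lambda>z. \<phi> (?c z))"
        by (rule continuous_on_compose2[OF continuous_on_subset[OF cont closure_subset]])
           (auto intro!: continuous_intros)
    qed (use oV in simp)
    show "norm (g z) \<le> \<bar>M0\<bar>" for z
      using M0[of "?c z"] closure_subset[of ?U] by (auto simp: g_def indicator_def)
    show "g z = 0" if "z \<notin> cball 0 R" for z
      using RU[of "?c z"] that by (auto simp: g_def indicator_def norm_Pair cmod_def)
    show "g (Complex (fst p) (snd p)) = (if p \<in> ?U then f (slice_pt I p) else 0)" for p
      by (auto simp: g_def \<phi>_def)
    show "g differentiable (at (Complex (fst p) (snd p)))" if p: "p \<in> ?U" for p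
    proof -
      let ?z = "Complex (fst p) (snd p)"
      obtain D where "(\<phi> has_derivative D) (at p)"
        using C1 p unfolding C1_closure_def \<phi>_def by blast
      then have D: "(\<phi> has_derivative D) (at (?c ?z))" by simp
      have "(?c has_derivative ?c) (at ?z)"
        by (intro has_derivative_Pair has_derivative_Re has_derivative_Im has_derivative_ident)
      from has_derivative_compose[OF this D]
      have "((\<lambda>z. \<phi> (?c z)) has_derivative (\<lambda>z. D (?c z))) (at ?z)" by simp
      then have "(g has_derivative (\<lambda>z. D (?c z))) (at ?z)"
        by (rule has_derivative_transform_within_open[OF _ oV]) (use p in \<open>auto simp: g_def\<close>)
      then show ?thesis by (auto simp: differentiable_def)
    qed
  qed
qed

text \<open>The representation formula evaluates the Cauchy transform at both conjugate points, so
  the density must be differentiable at both. Axial symmetry puts them in the slice of every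
  \<open>I\<close>, including slices that do not contain \<open>q\<close>.\<close>

lemma axially_symmetric_slice_dom:
  assumes "axially_symmetric \<Omega>" "I \<in> unit_sph" "q \<in> \<Omega>"
  shows "(fst q, norm (snd q)) \<in> slice_dom \<Omega> I" "(fst q, - norm (snd q)) \<in> slice_dom \<Omega> I"
proof -
  obtain D where D: "cnj ` D = D" "\<Omega> = (\<Union>J\<in>unit_sph. {slice_pt J (Re z, Im z) | z. z \<in> D})"
    using assms(1) unfolding axially_symmetric_def by blast
  obtain J z where z: "J \<in> unit_sph" "z \<in> D" "q = slice_pt J (Re z, Im z)"
    using assms(3) D(2) by blast
  have n: "norm (snd q) = \<bar>Im z\<bar>" using z(1,3) by (simp add: slice_pt_def unit_sph_def)
  have "cnj z \<in> D" using z(2) D(1) by blast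
  then have "slice_pt I (Re z, Im z) \<in> \<Omega>" "slice_pt I (Re z, - Im z) \<in> \<Omega>"
    using z(2) assms(2) unfolding D(2) by (auto intro!: exI[of _ z], force)
  then show "(fst q, norm (snd q)) \<in> slice_dom \<Omega> I" "(fst q, - norm (snd q)) \<in> slice_dom \<Omega> I"
    using z(3) n by (auto simp: slice_dom_def abs_if)
qed

text \<open>The constant coefficients \<open>P\<close> and \<open>Q\<close> stand leftmost and so
  come out of the integral. The same statement serves the Cauchy kernel, with \<open>V\<close> the
  whole plane, and the squared kernel, with \<open>V\<close> the complement of the two
  discs.\<close>

lemma integral_slice_kernel:
  fixes f :: "real \<times> (real, 'n) vec \<Rightarrow> 'n::{finite,linorder} clif"
  assumes g: "\<And>p. g (Complex (fst p) (snd p)) = (if p \<in> slice_dom \<Omega> I then f (slice_pt I p) else 0)"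
    and int: "integrable lborel (\<lambda>x. indicator V x *\<^sub>R (slice_emb I (\<phi> x) \<odot> g x))"
      "integrable lborel (\<lambda>x. indicator V x *\<^sub>R (slice_emb I (\<psi> x) \<odot> g x))"
    and S: "\<And>p. p \<in> S \<longleftrightarrow> p \<in> slice_dom \<Omega> I \<and> Complex (fst p) (snd p) \<in> V"
    and N: "finite N"
    and k: "\<And>x. x \<notin> N \<Longrightarrow> k (slice_pt I (Re x, Im x)) = P \<odot> slice_emb I (\<phi> x) + Q \<odot> slice_emb I (\<psi> x)"
  shows "integral S (\<lambda>p. k (slice_pt I p) \<odot> f (slice_pt I p))
    = P \<odot> (\<integral>x. indicator V x *\<^sub>R (slice_emb I (\<phi> x) \<odot> g x) \<partial>lborel)
      + Q \<odot> (\<integral>x. indicator V x *\<^sub>R (slice_emb I (\<psi> x) \<odot> g x) \<partial>lborel)"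
proof -
  let ?A = "\<lambda>x. indicator V x *\<^sub>R (slice_emb I (\<phi> x) \<odot> g x)"
  let ?B = "\<lambda>x. indicator V x *\<^sub>R (slice_emb I (\<psi> x) \<odot> g x)"
  have PA: "integrable lborel (\<lambda>x. P \<odot> ?A x)" "(\<integral>x. P \<odot> ?A x \<partial>lborel) = P \<odot> (\<integral>x. ?A x \<partial>lborel)"
    using integrable_bounded_linear[OF cl.bounded_linear_right int(1)]
      integral_bounded_linear[OF cl.bounded_linear_right int(1)] by auto
  have QB: "integrable lborel (\<lambda>x. Q \<odot> ?B x)" "(\<integral>x. Q \<odot> ?B x \<partial>lborel) = Q \<odot> (\<integral>x. ?B x \<partial>lborel)"
    using integrable_bounded_linear[OF cl.bounded_linear_right int(2)]
      integral_bounded_linear[OF cl.bounded_linear_right int(2)] by auto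
  have "integral S (\<lambda>p. k (slice_pt I p) \<odot> f (slice_pt I p)) = (\<integral>x. P \<odot> ?A x + Q \<odot> ?B x \<partial>lborel)"
  proof (rule integral_plane_eq_lborel[OF _ N])
    fix p assume "Complex (fst p) (snd p) \<notin> N"
    from k[OF this]
    show "P \<odot> ?A (Complex (fst p) (snd p)) + Q \<odot> ?B (Complex (fst p) (snd p))
        = (if p \<in> S then k (slice_pt I p) \<odot> f (slice_pt I p) else 0)"
      by (auto simp: S g cl.add_left cl_mult_assoc cl.zero_right)
  qed (use PA QB in auto)
  also have "\<dots> = P \<odot> (\<integral>x. ?A x \<partial>lborel) + Q \<odot> (\<integral>x. ?B x \<partial>lborel)"
    using PA QB by simp
  finally show ?thesis .
qed

theorem theorem3p2:
  fixes \<Omega> :: "(real \<times> ((real, 'n::{finite,linorder}) vec)) set"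
    and I :: "(real, 'n) vec"
    and f :: "real \<times> ((real, 'n) vec) \<Rightarrow> 'n clif"
    and q :: "real \<times> ((real, 'n) vec)"
  assumes "open \<Omega>" and "connected \<Omega>" and "bounded \<Omega>"
    and "\<forall>x\<in>\<Omega>. snd x \<noteq> 0"
    and "axially_symmetric \<Omega>"
    and "I \<in> unit_sph"
    and "C1_closure (slice_dom \<Omega> I) (\<lambda>p. f (slice_pt I p))"
    and "q \<in> \<Omega>"
  shows "((\<lambda>\<epsilon>. - (1 / pi) *\<^sub>R integral (pv_dom \<Omega> I q \<epsilon>)
             (\<lambda>p. kernel2 q (slice_pt I p) \<odot> f (slice_pt I p)))
          \<longlongrightarrow> Pi_op \<Omega> I f q) (at_right 0)"
proof -
  note I = \<open>I \<in> unit_sph\<close>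
  interpret complex_action "\<lambda>z x. slice_emb I z \<odot> x"
    by (rule complex_action_slice_emb[OF I])
  have q0: "snd q \<noteq> 0" using assms by blast
  obtain g M R where g: "g \<in> borel_measurable borel" "\<And>z. norm (g z) \<le> M" "\<And>z. z \<notin> cball 0 R \<Longrightarrow> g z = 0"
    and gf: "\<And>p. g (Complex (fst p) (snd p)) = (if p \<in> slice_dom \<Omega> I then f (slice_pt I p) else 0)"
    and gdiff: "\<And>p. p \<in> slice_dom \<Omega> I \<Longrightarrow> g differentiable (at (Complex (fst p) (snd p)))"
    using slice_extension[OF assms(1,3,6,7)] by metis
  define F where "F w = (\<integral>x. slice_emb I (1 / (x - w)) \<odot> g x \<partial>lborel)" for w
  define c where "c = - (1 / (2 * pi))"
  let ?\<zeta> = "slice_coord q"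
  let ?P = "slice_proj (axis_dir q) I" and ?M = "slice_proj (axis_dir q) (- I)"
  have intF: "integrable lborel (\<lambda>x. slice_emb I (1 / (x - w)) \<odot> g x)" for w
  proof (rule integrable_cauchy[OF g(1,2), where R="R + norm w"])
    fix z assume "z \<notin> cball w (R + norm w)"
    then have "z \<notin> cball 0 R"
      using norm_triangle_ineq4[of z w] by (simp add: dist_norm norm_minus_commute)
    then show "g z = 0" by (rule g(3))
  qed
  \<comment> \<open>The formula is needed for all points off the real axis, not just the given
    \<open>q\<close>, because \<open>Gbar\<close> differentiates it in \<open>q\<close>.\<close>
  have T: "T_op \<Omega> I f q = c *\<^sub>R (slice_proj (axis_dir q) I \<odot> F (slice_coord q)
      + slice_proj (axis_dir q) (- I) \<odot> F (cnj (slice_coord q)))" if "snd q \<noteq> 0" for q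
  proof -
    have "integral (slice_dom \<Omega> I) (\<lambda>p. slice_cauchy q (slice_pt I p) \<odot> f (slice_pt I p))
      = slice_proj (axis_dir q) I \<odot> (\<integral>x. indicator UNIV x *\<^sub>R (slice_emb I (1 / (x - slice_coord q)) \<odot> g x) \<partial>lborel)
      + slice_proj (axis_dir q) (- I) \<odot> (\<integral>x. indicator UNIV x *\<^sub>R (slice_emb I (1 / (x - cnj (slice_coord q))) \<odot> g x) \<partial>lborel)"
    proof (rule integral_slice_kernel[OF gf, where N="{slice_coord q, cnj (slice_coord q)}"])
      show "slice_cauchy q (slice_pt I (Re x, Im x))
          = slice_proj (axis_dir q) I \<odot> slice_emb I (1 / (x - slice_coord q))
            + slice_proj (axis_dir q) (- I) \<odot> slice_emb I (1 / (x - cnj (slice_coord q)))"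
        if "x \<notin> {slice_coord q, cnj (slice_coord q)}" for x
        using slice_cauchy_representation[OF axis_dir_unit I, of q x "slice_coord q"] that \<open>snd q \<noteq> 0\<close>
        by (simp add: slice_pt_axis_dir)
    qed (use intF in auto)
    then show ?thesis by (simp add: T_op_def F_def c_def)
  qed
  have r: "Im ?\<zeta> > 0" using q0 by (simp add: slice_coord_def)
  then have ne: "cnj ?\<zeta> \<noteq> ?\<zeta>" by (simp add: complex_eq_iff)
  have \<zeta>: "?\<zeta> = Complex (fst (fst q, norm (snd q))) (snd (fst q, norm (snd q)))"
    "cnj ?\<zeta> = Complex (fst (fst q, - norm (snd q))) (snd (fst q, - norm (snd q)))"
    by (simp_all add: slice_coord_def complex_eq_iff)
  obtain g1 g2 where g1: "(g has_derivative g1) (at ?\<zeta>)" and g2: "(g has_derivative g2) (at (cnj ?\<zeta>))"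
    using gdiff[OF axially_symmetric_slice_dom(1)[OF assms(5,6,8)]]
      gdiff[OF axially_symmetric_slice_dom(2)[OF assms(5,6,8)]]
    unfolding \<zeta>[symmetric] differentiable_def by blast
  let ?V = "\<lambda>\<epsilon>. {z. dist z ?\<zeta> > \<epsilon> \<and> dist z (cnj ?\<zeta>) > \<epsilon>}"
  have V': "{z. dist z (cnj ?\<zeta>) > \<epsilon> \<and> dist z ?\<zeta> > \<epsilon>} = ?V \<epsilon>" for \<epsilon> by auto
  let ?I1 = "\<lambda>\<epsilon>. \<integral>z. indicator (?V \<epsilon>) z *\<^sub>R (slice_emb I (1 / (z - ?\<zeta>)\<^sup>2) \<odot> g z) \<partial>lborel"
  let ?I2 = "\<lambda>\<epsilon>. \<integral>z. indicator (?V \<epsilon>) z *\<^sub>R (slice_emb I (1 / (z - cnj ?\<zeta>)\<^sup>2) \<odot> g z) \<partial>lborel"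
  obtain A1 H1 where H1:
    "(F has_derivative (\<lambda>d. slice_emb I (A1 * cnj d) \<odot> g ?\<zeta> + slice_emb I d \<odot> H1)) (at ?\<zeta>)"
    "(?I1 \<longlongrightarrow> H1) (at_right 0)"
    using cauchy_transform_has_derivative_pv[OF g g1 ne] unfolding F_def[abs_def] by blast
  obtain A2 H2 where H2:
    "(F has_derivative (\<lambda>d. slice_emb I (A2 * cnj d) \<odot> g (cnj ?\<zeta>) + slice_emb I d \<odot> H2)) (at (cnj ?\<zeta>))"
    "(?I2 \<longlongrightarrow> H2) (at_right 0)"
    using cauchy_transform_has_derivative_pv[OF g g2 ne[symmetric]] unfolding F_def[abs_def] V' by blast
  \<comment> \<open>Since \<open>\<i> * cnj \<i>\<close> is 1, the conjugate-linear part cancels;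
    since \<open>\<i> * \<i>\<close> is -1, the complex-linear part is counted twice.\<close>
  have wirtinger: "slice_emb I (A * cnj 1) \<odot> y + slice_emb I 1 \<odot> H
      - slice_emb I \<i> \<odot> (slice_emb I (A * cnj \<i>) \<odot> y + slice_emb I \<i> \<odot> H) = 2 *\<^sub>R H" for A y H
  proof -
    have "\<i> * (A * cnj \<i>) = A" by (simp add: complex_eq_iff)
    then show ?thesis
      unfolding add_right act_mult[symmetric] by (simp add: slice_emb_minus cl.minus_left scaleR_2)
  qed
  have "Pi_op \<Omega> I f q = c *\<^sub>R (?P \<odot> (2 *\<^sub>R H1) + ?M \<odot> (2 *\<^sub>R H2))"
    using Gbar_slice_combination[OF q0 I H1(1) H2(1), of "T_op \<Omega> I f" c] T
    unfolding Pi_op_def wirtinger by blast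
  also have "\<dots> = - (1 / pi) *\<^sub>R (?P \<odot> H1 + ?M \<odot> H2)"
    by (simp add: cl.scaleR_right c_def scaleR_add_right)
  finally have Pi: "Pi_op \<Omega> I f q = - (1 / pi) *\<^sub>R (?P \<odot> H1 + ?M \<odot> H2)" .
  have pv: "integral (pv_dom \<Omega> I q \<epsilon>) (\<lambda>p. kernel2 q (slice_pt I p) \<odot> f (slice_pt I p))
      = ?P \<odot> ?I1 \<epsilon> + ?M \<odot> ?I2 \<epsilon>" if "\<epsilon> > 0" for \<epsilon>
  proof (rule integral_slice_kernel[OF gf, where N="{?\<zeta>, cnj ?\<zeta>}"])
    show "kernel2 q (slice_pt I (Re x, Im x))
        = ?P \<odot> slice_emb I (1 / (x - ?\<zeta>)\<^sup>2) + ?M \<odot> slice_emb I (1 / (x - cnj ?\<zeta>)\<^sup>2)"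
      if "x \<notin> {?\<zeta>, cnj ?\<zeta>}" for x
      using kernel2_representation[OF axis_dir_unit[OF q0] I, of x "?\<zeta>"] that
      by (simp add: slice_pt_axis_dir[OF q0])
    show "p \<in> pv_dom \<Omega> I q \<epsilon> \<longleftrightarrow> p \<in> slice_dom \<Omega> I \<and> Complex (fst p) (snd p) \<in> ?V \<epsilon>" for p
      by (auto simp: pv_dom_def slice_coord_def dist_norm cmod_def norm_Pair norm_prod_def)
    show "integrable lborel (\<lambda>z. indicator (?V \<epsilon>) z *\<^sub>R (slice_emb I (1 / (z - cnj ?\<zeta>)\<^sup>2) \<odot> g z))"
      using integrable_cauchy_square_truncated[OF g \<open>\<epsilon> > 0\<close>, where ?w0.0="cnj ?\<zeta>" and ?w1.0="?\<zeta>"] unfolding V' .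
  qed (use integrable_cauchy_square_truncated[OF g \<open>\<epsilon> > 0\<close>] in auto)
  have "((\<lambda>\<epsilon>. - (1 / pi) *\<^sub>R (?P \<odot> ?I1 \<epsilon> + ?M \<odot> ?I2 \<epsilon>)) \<longlongrightarrow> Pi_op \<Omega> I f q) (at_right 0)"
    unfolding Pi
    by (intro tendsto_scaleR[OF tendsto_const] tendsto_add cl.tendsto[OF tendsto_const] H1(2) H2(2))
  moreover have "eventually (\<lambda>\<epsilon>. - (1 / pi) *\<^sub>R (?P \<odot> ?I1 \<epsilon> + ?M \<odot> ?I2 \<epsilon>)
      = - (1 / pi) *\<^sub>R integral (pv_dom \<Omega> I q \<epsilon>) (\<lambda>p. kernel2 q (slice_pt I p) \<odot> f (slice_pt I p))) (at_right 0)"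
    using eventually_at_right_less[of "0::real"] by eventually_elim (simp add: pv)
  ultimately show ?thesis by (rule Lim_transform_eventually)
qed

end
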